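(* Let $0<\epsilon<1$. Let $\mathcal{N}^{AB\to E}$ be a channel (a completely positive trace non-increasing superoperator), let $\{\rho_x^A\}_{x\in\mathcal{X}}$, $\{\rho_y^B\}_{y\in\mathcal{Y}}$ be ensembles of quantum states, let $\mathcal{X}',\mathcal{Y}'$ be further alphabets, and let $p(x',x,y',y)=p(x',x)p(y',y)$ be a probability distribution on $\mathcal{X}'\times\mathcal{X}\times\mathcal{Y}'\times\mathcal{Y}$. Let \[ \sigma^{X'XY'YE}:=\sum_{x',x,y',y}p(x',x)p(y',y)\,|x',x,y',y\rangle\langle x',x,y',y|^{X'XY'Y}\otimes\sigma^E_{x'xy'y},\qquad \sigma^E_{x'xy'y}:=\mathcal{N}(\rho_x^A\otimes\rho_y^B). \] Let $L',L,M',M$ be positive integers such that \begin{align*} \log L'&>I_2^\epsilon(X':E)_\sigma+\log\epsilon^{-2},\\ \log M'&>I_2^\epsilon(Y':E)_\sigma+\log\epsilon^{-2},\\ \log L'+\log L&>I_2^\epsilon(X'X:E)_\sigma+\log\epsilon^{-2},\\ \log M'+\log M&>I_2^\epsilon(Y'Y:E)_\sigma+\log\epsilon^{-2},\\ \log L'+\log M'&>I_2^\epsilon(X'Y':E)_\sigma+\log\epsilon^{-2},\\ \log L'+\log M'+\log M&>I_2^\epsilon(X'Y'Y:E)_\sigma+\log\epsilon^{-2},\\ \log L'+\log M'+\log L&>I_2^\epsilon(X'XY':E)_\sigma+\log\epsilon^{-2},\\ \log L'+\log M'+\log L+\log M&>I_2^\epsilon(X'XY'Y:E)_\sigma+\log\epsilon^{-2}.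 \end{align*} Let $\mathrm{CMG}$ denote the CMG convex split quantity \[ \mathrm{CMG}:=\mathbb{E}_{\vec{x'},\vec{x},\vec{y'},\vec{y}}\Big[\Big\|(L'LM'M)^{-1}\sum_{a'=1}^{L'}\sum_{a=1}^{L}\sum_{b'=1}^{M'}\sum_{b=1}^{M}\sigma^E_{x'_{a'}x_{a'a}y'_{b'}y_{b'b}}-\sigma^E\Big\|_1\Big]. \] Then $\mathrm{CMG}<31\epsilon$.
   Context: Sampling in the definition of $\mathrm{CMG}$: $x'_1,\ldots,x'_{L'}$ are iid from the marginal $p^{X'}$; conditioned on these, for each $a'\in[L']$, $x_{a',1},\ldots,x_{a',L}$ are iid from the conditional distribution $p(\cdot|x'_{a'})$ of $X$ given $X'=x'_{a'}$ (independently over $a'$). Independently of these, $y'_1,\ldots,y'_{M'}$ are iid from $p^{Y'}$ and for each $b'\in[M']$, $y_{b',1},\ldots,y_{b',M}$ are iid from $p(\cdot|y'_{b'})$. $\sigma^E$ is the marginal on $E$ of $\sigma^{X'XY'YE}$. Alphabets are finite, Hilbert spaces finite dimensional, logarithms base 2. A subnormalised density matrix is positive semidefinite with trace at most one. $\|\cdot\|_p$ is the Schatten-$\ell_p$ norm; negative powers of positive semidefinite matrices are on the support (Moore-Penrose). For a subnormalised density matrix $\alpha$ and positive semidefinite $\beta$ on the same space, $D_2(\alpha\|\beta):=2\log\|\beta^{-1/4}\alpha\beta^{-1/4}\|_2$ if $\mathrm{supp}(\alpha)\subseteq\mathrm{supp}(\beta)$, and $+\infty$ otherwise; $D_2^\epsilon(\alpha\|\beta):=\min_{\alpha'}D_2(\alpha'\|\beta)$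 over all subnormalised density matrices $\alpha'$ with $\|\alpha'-\alpha\|_1\le\epsilon(\mathrm{Tr}\,\alpha)$. For a subcollection $W$ of the systems $X',X,Y',Y$, $I_2^\epsilon(W:E)_\sigma:=D_2^\epsilon(\sigma^{WE}\|\sigma^W\otimes\sigma^E)$, with marginals given by partial trace. *)

theory Defs
  imports "HOL-Probability.Probability" "HOL-Library.Nonpos_Ints"
begin

text \<open>
  An operator on a finite-dimensional Hilbert space is a square complex matrix indexed by a finite
  type; composite systems are indexed by product types. Classical alphabets are finite types.
\<close>

type_synonym 'n op = "complex^'n^'n"


subsection \<open>Positive operators and their functional calculus\<close>

definition dagger :: "complex^'n^'m \<Rightarrow> complex^'m^'n" where
  "dagger A = (\<chi> i j. cnj (A $ j $ i))"

definition cinner :: "complex^'n \<Rightarrow> complex^'n \<Rightarrow> complex" where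
  "cinner v w = (\<Sum>i\<in>UNIV. cnj (v $ i) * w $ i)"

text \<open>Over the complex numbers a non-negative quadratic form already forces hermiticity.\<close>

definition psd :: "'n::finite op \<Rightarrow> bool" where
  "psd A \<longleftrightarrow> (\<forall>v. cinner v (A *v v) \<in> \<real>\<^sub>\<ge>\<^sub>0)"

definition density_op :: "'n::finite op \<Rightarrow> bool" where
  "density_op A \<longleftrightarrow> psd A \<and> trace A = 1"

definition subnormalised :: "'n::finite op \<Rightarrow> bool" where
  "subnormalised A \<longleftrightarrow> psd A \<and> Re (trace A) \<le> 1"

definition unitary :: "'n::finite op \<Rightarrow> bool" where
  "unitary U \<longleftrightarrow> dagger U ** U = mat 1 \<and> U ** dagger U = mat 1"

definition real_diag :: "('n \<Rightarrow> real) \<Rightarrow> 'n::finite op" where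
  "real_diag d = (\<chi> i j. if i = j then complex_of_real (d i) else 0)"

text \<open>
  \<open>spectral_fun f A\<close> applies \<open>f\<close> to the eigenvalues of the hermitian matrix \<open>A\<close>. The lemma
  \<open>spectral_fun_eq\<close> below shows that the result does not depend on the chosen
  diagonalisation.
\<close>

definition spectral_fun :: "(real \<Rightarrow> real) \<Rightarrow> 'n::finite op \<Rightarrow> 'n op" where
  "spectral_fun f A = (SOME B. \<exists>U d. unitary U \<and> A = U ** real_diag d ** dagger U \<and>
                                   B = U ** real_diag (\<lambda>i. f (d i)) ** dagger U)"

text \<open>
  Since \<open>0 powr s = 0\<close> for every \<open>s\<close>, zero eigenvalues stay zero, so negative powers are taken on
  the support (Moore-Penrose).
\<close>

definition op_powr :: "'n::finite op \<Rightarrow> real \<Rightarrow> 'n op" where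
  "op_powr A s = spectral_fun (\<lambda>x. x powr s) A"

definition schatten_norm :: "real \<Rightarrow> 'n::finite op \<Rightarrow> real" where
  "schatten_norm p A = (Re (trace (op_powr (dagger A ** A) (p / 2)))) powr (1 / p)"

text \<open>Used for hermitian operators only, whose support is their range.\<close>

definition supp :: "'n::finite op \<Rightarrow> (complex^'n) set" where
  "supp A = range (\<lambda>v. A *v v)"

lemma real_diag_left: "(real_diag d ** A) $ i $ j = complex_of_real (d i) * A $ i $ j"
proof -
  have "(real_diag d ** A) $ i $ j = (\<Sum>k\<in>UNIV. if k = i then complex_of_real (d i) * A $ i $ j else 0)"
    unfolding matrix_matrix_mult_def real_diag_def by (simp del: sum.delta sum.delta', rule sum.cong, auto)
  thus ?thesis by simp
qed

lemma real_diag_right: "(A ** real_diag d) $ i $ j = A $ i $ j * complex_of_real (d j)"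
proof -
  have "(A ** real_diag d) $ i $ j = (\<Sum>k\<in>UNIV. if k = j then A $ i $ j * complex_of_real (d j) else 0)"
    unfolding matrix_matrix_mult_def real_diag_def by (simp del: sum.delta sum.delta', rule sum.cong, auto)
  thus ?thesis by simp
qed

lemma spectral_fun_unique:
  fixes U V :: "'n::finite op"
  assumes U: "unitary U" and V: "unitary V"
    and eq: "U ** real_diag d ** dagger U = V ** real_diag e ** dagger V"
  shows "U ** real_diag (\<lambda>i. f (d i)) ** dagger U = V ** real_diag (\<lambda>i. f (e i)) ** dagger V"
proof -
  define W where "W = dagger V ** U"
  note UV = U[unfolded unitary_def] V[unfolded unitary_def]
  have "real_diag e ** W = dagger V ** (V ** real_diag e ** dagger V) ** U"
    unfolding W_def using UV by (metis matrix_mul_assoc matrix_mul_lid)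
  also have "\<dots> = W ** real_diag d"
    unfolding eq[symmetric] W_def using UV by (metis matrix_mul_assoc matrix_mul_rid)
  finally have c: "real_diag e ** W = W ** real_diag d" .
  have "real_diag (\<lambda>i. f (e i)) ** W = W ** real_diag (\<lambda>i. f (d i))"
  proof -
    have "(real_diag (\<lambda>i. f (e i)) ** W) $ i $ j = (W ** real_diag (\<lambda>i. f (d i))) $ i $ j" for i j
    proof -
      have "complex_of_real (e i) * W $ i $ j = W $ i $ j * complex_of_real (d j)"
        using c real_diag_left real_diag_right by metis
      hence "e i = d j \<or> W $ i $ j = 0" by (auto simp: mult.commute)
      thus ?thesis by (auto simp: real_diag_left real_diag_right)
    qed
    thus ?thesis by (simp add: vec_eq_iff)
  qed
  hence "V ** (real_diag (\<lambda>i. f (e i)) ** W) ** dagger U = V ** (W ** real_diag (\<lambda>i. f (d i))) ** dagger U"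
    by simp
  moreover have "V ** (real_diag (\<lambda>i. f (e i)) ** W) ** dagger U = V ** real_diag (\<lambda>i. f (e i)) ** dagger V"
    unfolding W_def using UV by (metis matrix_mul_assoc matrix_mul_rid)
  moreover have "V ** (W ** real_diag (\<lambda>i. f (d i))) ** dagger U = U ** real_diag (\<lambda>i. f (d i)) ** dagger U"
    unfolding W_def using UV by (metis matrix_mul_assoc matrix_mul_lid)
  ultimately show ?thesis by simp
qed

lemma spectral_fun_eq:
  assumes "unitary U"
  shows "spectral_fun f (U ** real_diag d ** dagger U) = U ** real_diag (\<lambda>i. f (d i)) ** dagger U"
  unfolding spectral_fun_def
proof (rule some_equality)
  show "\<exists>V e. unitary V \<and> U ** real_diag d ** dagger U = V ** real_diag e ** dagger V \<and>
      U ** real_diag (\<lambda>i. f (d i)) ** dagger U = V ** real_diag (\<lambda>i. f (e i)) ** dagger V"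
    using assms by blast
qed (use assms spectral_fun_unique in metis)


subsection \<open>Tensor products and partial traces\<close>

definition tensor :: "'a::finite op \<Rightarrow> 'b::finite op \<Rightarrow> ('a \<times> 'b) op" where
  "tensor A B = (\<chi> i j. A $ fst i $ fst j * B $ snd i $ snd j)"

definition basis_proj :: "'a::finite \<Rightarrow> 'a op" where
  "basis_proj x = (\<chi> i j. if i = x \<and> j = x then 1 else 0)"

text \<open>
  Let the bijection \<open>glue\<close> assemble an index of a composite system from an index in \<open>'w\<close> for the
  subsystems to be kept and an index in \<open>'r\<close> for the remaining ones. Then \<open>ptrace glue\<close>
  traces out the remaining subsystems.
\<close>

definition ptrace :: "('w::finite \<times> 'r::finite \<Rightarrow> 'n::finite) \<Rightarrow> 'n op \<Rightarrow> 'w op" where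
  "ptrace glue A = (\<chi> i j. \<Sum>r\<in>UNIV. A $ glue (i, r) $ glue (j, r))"


subsection \<open>Channels\<close>

definition op_linear :: "('a::finite op \<Rightarrow> 'b::finite op) \<Rightarrow> bool" where
  "op_linear N \<longleftrightarrow> (\<forall>A B. N (A + B) = N A + N B) \<and>
                   (\<forall>c A. N (\<chi> i j. c * A $ i $ j) = (\<chi> i j. c * N A $ i $ j))"

text \<open>
  An operator on the tensor product of an \<open>n\<close>-dimensional ancilla with a system is
  given by its \<open>n \<times> n\<close> blocks \<open>X i j\<close>, \<open>i, j < n\<close>; the identity on the ancilla tensored with \<open>N\<close>
  acts on such an operator blockwise.
\<close>

definition psd_blocks :: "nat \<Rightarrow> (nat \<Rightarrow> nat \<Rightarrow> 'a::finite op) \<Rightarrow> bool" where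
  "psd_blocks n X \<longleftrightarrow>
     (\<forall>v :: nat \<Rightarrow> complex^'a. (\<Sum>i<n. \<Sum>j<n. cinner (v i) (X i j *v v j)) \<in> \<real>\<^sub>\<ge>\<^sub>0)"

definition completely_positive :: "('a::finite op \<Rightarrow> 'b::finite op) \<Rightarrow> bool" where
  "completely_positive N \<longleftrightarrow>
     (\<forall>n X. psd_blocks n X \<longrightarrow> psd_blocks n (\<lambda>i j. N (X i j)))"

definition trace_nonincreasing :: "('a::finite op \<Rightarrow> 'b::finite op) \<Rightarrow> bool" where
  "trace_nonincreasing N \<longleftrightarrow> (\<forall>A. psd A \<longrightarrow> Re (trace (N A)) \<le> Re (trace A))"

definition channel :: "('a::finite op \<Rightarrow> 'b::finite op) \<Rightarrow> bool" where
  "channel N \<longleftrightarrow> op_linear N \<and> completely_positive N \<and> trace_nonincreasing N"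


subsection \<open>Smooth collision entropies\<close>

text \<open>In HOL \<open>log 2 0 = 0\<close>; here \<open>log 0\<close> is minus infinity.\<close>

definition elog2 :: "real \<Rightarrow> ereal" where
  "elog2 x = (if x = 0 then -\<infinity> else ereal (log 2 x))"

definition D2 :: "'n::finite op \<Rightarrow> 'n op \<Rightarrow> ereal" where
  "D2 \<alpha> \<beta> =
     (if supp \<alpha> \<subseteq> supp \<beta>
      then 2 * elog2 (schatten_norm 2 (op_powr \<beta> (- 1/4) ** \<alpha> ** op_powr \<beta> (- 1/4)))
      else \<infinity>)"

text \<open>
  The infimum is attained, by compactness, so that it is the minimum: the feasible set and its
  intersection with the operators supported in \<open>supp \<beta>\<close> are compact, and on the latter
  the norm above is continuous.
\<close>

definition smooth_D2 :: "real \<Rightarrow> 'n::finite op \<Rightarrow> 'n op \<Rightarrow> ereal" where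
  "smooth_D2 \<epsilon> \<alpha> \<beta> =
     (INF \<alpha>' \<in> {\<alpha>'. subnormalised \<alpha>' \<and> schatten_norm 1 (\<alpha>' - \<alpha>) \<le> \<epsilon> * Re (trace \<alpha>)}. D2 \<alpha>' \<beta>)"

text \<open>\<open>smooth_I2 \<epsilon> \<tau>\<close> is the information between the two factors of a bipartite \<open>\<tau>\<close>.\<close>

definition smooth_I2 :: "real \<Rightarrow> ('w::finite \<times> 'e::finite) op \<Rightarrow> ereal" where
  "smooth_I2 \<epsilon> \<tau> =
     smooth_D2 \<epsilon> \<tau> (tensor (ptrace (\<lambda>(w, e). (w, e)) \<tau>) (ptrace (\<lambda>(e, w). (w, e)) \<tau>))"


subsection \<open>The CMG convex split quantity\<close>

text \<open>The type variables \<open>'x1\<close> and \<open>'y1\<close> stand for the primed alphabets.\<close>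

definition cmg_state ::
  "('x1::finite \<times> 'x::finite) pmf \<Rightarrow> ('y1::finite \<times> 'y::finite) pmf \<Rightarrow>
   ('x1 \<Rightarrow> 'x \<Rightarrow> 'y1 \<Rightarrow> 'y \<Rightarrow> 'e::finite op) \<Rightarrow> (('x1 \<times> 'x \<times> 'y1 \<times> 'y) \<times> 'e) op" where
  "cmg_state pX pY \<sigma>E =
     (\<Sum>x'\<in>UNIV. \<Sum>x\<in>UNIV. \<Sum>y'\<in>UNIV. \<Sum>y\<in>UNIV.
        (pmf pX (x', x) * pmf pY (y', y)) *\<^sub>R
          tensor (basis_proj (x', x, y', y)) (\<sigma>E x' x y' y))"

text \<open>
  Conditional distribution of the second component given that the first one equals \<open>x'\<close>;
  meaningful if \<open>x'\<close> has positive probability.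
\<close>

definition conditional :: "('x1 \<times> 'x) pmf \<Rightarrow> 'x1 \<Rightarrow> 'x pmf" where
  "conditional p x' = map_pmf snd (cond_pmf p {z. fst z = x'})"

text \<open>
  The pair \<open>(x'\<^sub>a)\<^sub>a\<close>, \<open>(x\<^sub>a\<^sub>b)\<^sub>a\<^sub>b\<close> with \<open>1 \<le> a \<le> L'\<close>, \<open>1 \<le> b \<le> L\<close>. Values at indices out of
  range are irrelevant.
\<close>

definition codebook :: "('x1 \<times> 'x) pmf \<Rightarrow> nat \<Rightarrow> nat \<Rightarrow> ((nat \<Rightarrow> 'x1) \<times> (nat \<times> nat \<Rightarrow> 'x)) pmf" where
  "codebook p L' L =
     bind_pmf (Pi_pmf {1..L'} undefined (\<lambda>_. map_pmf fst p)) (\<lambda>xs'.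
       map_pmf (\<lambda>xs. (xs', xs))
         (Pi_pmf ({1..L'} \<times> {1..L}) undefined (\<lambda>(a', a). conditional p (xs' a'))))"

definition CMG ::
  "('x1::finite \<times> 'x::finite) pmf \<Rightarrow> ('y1::finite \<times> 'y::finite) pmf \<Rightarrow>
   ('x1 \<Rightarrow> 'x \<Rightarrow> 'y1 \<Rightarrow> 'y \<Rightarrow> 'e::finite op) \<Rightarrow> nat \<Rightarrow> nat \<Rightarrow> nat \<Rightarrow> nat \<Rightarrow> real" where
  "CMG pX pY \<sigma>E L' L M' M =
     measure_pmf.expectation (pair_pmf (codebook pX L' L) (codebook pY M' M))
       (\<lambda>((xs', xs), (ys', ys)).
          schatten_norm 1
            ((1 / real (L' * L * M' * M)) *\<^sub>R
               (\<Sum>a'=1..L'. \<Sum>a=1..L. \<Sum>b'=1..M'. \<Sum>b=1..M.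
                  \<sigma>E (xs' a') (xs (a', a)) (ys' b') (ys (b', b)))
             - ptrace (\<lambda>(e, w). (w, e)) (cmg_state pX pY \<sigma>E)))"

end

theory Submission
  imports Defs
begin

text \<open>
  The letters of a codebook fall into three levels: nothing, the primed letter, both letters. With
  \<open>E\<^sub>i\<close> the difference of the conditional expectations onto levels \<open>i\<close> and \<open>i - 1\<close>, the codebook
  average \<open>S\<close> satisfies \<open>\<bbbE>\<parallel>S f\<parallel>\<^sup>2 = \<Sum>\<^sub>i \<parallel>E\<^sub>i f\<parallel>\<^sup>2 / n\<^sub>i\<close>, where \<open>n\<^sub>i\<close> is \<open>1\<close>, \<open>L'\<close> or \<open>L' * L\<close>; for two
  codebooks the identity tensorises. Now \<open>\<sigma> - \<bbbE>\<sigma>\<close> is the sum of \<open>E\<^sub>i F\<^sub>j \<sigma>\<close> over the eight pairs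
  \<open>(i, j) \<noteq> (0, 0)\<close>. In each of them \<open>\<sigma>\<close> is replaced by the optimiser \<open>\<alpha>\<^sub>i\<^sub>j\<close> of the corresponding
  smooth entropy, pinched to its diagonal blocks. Since \<open>E\<^sub>i\<close> has \<open>\<ell>\<^sub>1\<close>-norm at most \<open>1, 2, 2\<close>, this
  costs at most \<open>((1 + 2 + 2)\<^sup>2 - 1) \<epsilon> = 24 \<epsilon>\<close> in trace norm. The terms \<open>E\<^sub>i F\<^sub>j \<alpha>\<^sub>i\<^sub>j\<close> are orthogonal, so
  their sum has second moment at most \<open>8 \<epsilon>\<^sup>2\<close> after conjugation with \<open>(\<sigma>\<^sup>E)\<^sup>-\<^sup>1\<^sup>/\<^sup>4\<close>, which by
  \<open>2xy \<le> \<epsilon>x\<^sup>2 + y\<^sup>2/\<epsilon>\<close> contributes at most \<open>9/2 \<epsilon>\<close>.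
\<close>

subsection \<open>The spectral theorem\<close>

text \<open>The eight smooth entropies have eight unrelated optimisers, which need not be marginals
  of one common operator, so \<open>\<sigma>\<close> cannot be smoothed once and for all. This
  dictates the order: decompose, smooth each component separately, then apply \<open>E_i F_j\<close>
  again to the replacement. Since the \<open>E_i F_j\<close> annihilate each other, the replaced
  components stay orthogonal whatever the optimisers are, and each second moment is controlled by
  its own condition. The optimiser at \<open>(i, j)\<close> sees the letters only up to these
  levels, so it approximates a conditional expectation of \<open>\<sigma>\<close> and not
  \<open>\<sigma>\<close> itself; this is harmless because both have the same image under
  \<open>E_i F_j\<close>. The price is that the smoothing errors pass through differences of
  conditional expectations, hence the factors 2. The second moment enters through an inequality
  linear in the squared norm, so that expectations can be inserted directly. Since
  \<open>\<sigma>^E\<close> has trace at most 1, that part is \<epsilon>/2 + 8 \<epsilon>^2 / (2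
  \<epsilon>), and the total 57/2 \<epsilon> lies below 31 \<epsilon>.\<close>

definition hermitian :: "'n::finite op \<Rightarrow> bool" where
  "hermitian A \<longleftrightarrow> dagger A = A"

lemma dagger_nth [simp]: "dagger A $ i $ j = cnj (A $ j $ i)"
  by (simp add: dagger_def)

lemma dagger_dagger [simp]: "dagger (dagger A) = A"
  by (simp add: vec_eq_iff)

lemma dagger_mult: "dagger (A ** B) = dagger B ** dagger A"
  by (simp add: vec_eq_iff matrix_matrix_mult_def mult.commute)

lemma dagger_real_diag [simp]: "dagger (real_diag d) = real_diag d"
  by (auto simp: vec_eq_iff real_diag_def)

lemma dagger_diff: "dagger (A - B) = dagger A - dagger B"
  by (simp add: vec_eq_iff)

lemma dagger_mat_1 [simp]: "dagger (mat 1) = mat 1"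
  by (simp add: vec_eq_iff mat_def)

lemma real_diag_mult: "real_diag d ** real_diag e = real_diag (\<lambda>i. d i * e i)"
  by (simp add: vec_eq_iff real_diag_left) (simp add: real_diag_def)

lemma real_diag_1: "real_diag (\<lambda>_. 1) = mat 1"
  by (simp add: vec_eq_iff real_diag_def mat_def)

lemma unitary_dagger: "unitary U \<Longrightarrow> unitary (dagger U)"
  by (simp add: unitary_def)

lemma unitary_mult:
  assumes "unitary U" "unitary V" shows "unitary (U ** V)"
proof -
  have "dagger V ** dagger U ** (U ** V) = dagger V ** (dagger U ** U) ** V"
    by (simp add: matrix_mul_assoc)
  moreover have "U ** V ** (dagger V ** dagger U) = U ** (V ** dagger V) ** dagger U"
    by (simp add: matrix_mul_assoc)
  ultimately show ?thesis
    using assms by (simp add: unitary_def dagger_mult)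
qed

lemma inner_eq_Re_cinner: "inner v w = Re (cinner v w)"
  by (simp add: inner_vec_def cinner_def inner_complex_def)

lemma cinner_add_right: "cinner u (v + w) = cinner u v + cinner u w"
  by (simp add: cinner_def distrib_left sum.distrib)

lemma cinner_scale_right: "cinner u (c *s v) = c * cinner u v"
  by (simp add: cinner_def sum_distrib_left mult.left_commute)

lemma cinner_scale_left: "cinner (c *s u) v = cnj c * cinner u v"
  by (simp add: cinner_def sum_distrib_left mult.assoc)

lemma cinner_commute: "cinner v u = cnj (cinner u v)"
  by (simp add: cinner_def mult.commute)

lemma cinner_self: "cinner v v = complex_of_real ((norm v)\<^sup>2)"
proof -
  have "Im (cinner v v) = 0"
    by (simp add: cinner_def)
  moreover have "Re (cinner v v) = (norm v)\<^sup>2"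
    by (simp add: inner_eq_Re_cinner[symmetric] power2_norm_eq_inner)
  ultimately show ?thesis by (simp add: complex_eq_iff)
qed

lemma cinner_dagger: "cinner (dagger A *v u) v = cinner u (A *v v)"
  unfolding cinner_def matrix_vector_mult_def
  by (simp add: sum_distrib_left sum_distrib_right mult_ac) (rule sum.swap)

lemma matrix_vector_mult_scaleR:
  fixes A :: "'n::finite op" shows "A *v (c *\<^sub>R v) = c *\<^sub>R (A *v v)"
  by (simp add: vec_eq_iff matrix_vector_mult_def scaleR_sum_right)

lemma matrix_vector_mult_scale:
  fixes A :: "'n::finite op" shows "A *v (c *s v) = c *s (A *v v)"
  by (simp add: vec_eq_iff matrix_vector_mult_def sum_distrib_left mult_ac)

text \<open>The maximiser \<open>v\<close> of the Rayleigh quotient on the unit sphere of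
  \<open>S\<close> is an eigenvector: \<open>B\<close>, which is \<open>q v\<close> times the
  identity minus \<open>A\<close>, is a nonnegative form on \<open>S\<close> that vanishes at
  \<open>v\<close>, and this forces \<open>B v = 0\<close>. Only the real inner product enters, so
  \<open>S\<close> may be a real subspace.\<close>

lemma hermitian_eigenvector:
  fixes A :: "'n::finite op"
  assumes A: "hermitian A" and S: "subspace S" and nz: "\<exists>v\<in>S. v \<noteq> 0"
    and inv: "\<And>v. v \<in> S \<Longrightarrow> A *v v \<in> S"
  shows "\<exists>v\<in>S. norm v = 1 \<and> (\<exists>c. A *v v = c *\<^sub>R v)"
proof -
  define q where "q v = inner v (A *v v)" for v
  have sa: "inner u (A *v v) = inner v (A *v u)" for u v
    using cinner_dagger[of A u v] A cinner_commute[of v "A *v u"]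
    by (simp add: inner_eq_Re_cinner hermitian_def)
  obtain v0 where v0: "v0 \<in> S" "v0 \<noteq> 0" using nz by blast
  have lin: "linear ((*v) A)"
    by (rule linearI) (simp_all add: matrix_vector_right_distrib matrix_vector_mult_scaleR)
  have "compact (S \<inter> sphere 0 1)"
    using closed_subspace[OF S] by (simp add: closed_Int_compact)
  moreover have "(1 / norm v0) *\<^sub>R v0 \<in> S \<inter> sphere 0 1"
    using v0 S by (simp add: subspace_scale)
  moreover have "continuous_on (S \<inter> sphere 0 1) q"
    unfolding q_def by (intro continuous_intros linear_continuous_on_compose[OF _ lin])
  ultimately obtain v where v: "v \<in> S" "norm v = 1"
    and max: "\<And>w. w \<in> S \<Longrightarrow> norm w = 1 \<Longrightarrow> q w \<le> q v"
    using continuous_attains_sup[of "S \<inter> sphere 0 1" q] by (metis IntE IntI dist_0_norm empty_iff mem_sphere)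
  define B where "B w = q v *\<^sub>R w - A *v w" for w
  have linB: "B (a + b) = B a + B b" "B (c *\<^sub>R a) = c *\<^sub>R B a" for a b c
    by (simp_all add: B_def algebra_simps matrix_vector_right_distrib matrix_vector_mult_scaleR)
  have BS: "B w \<in> S" if "w \<in> S" for w
    unfolding B_def using that inv S by (simp add: subspace_diff subspace_scale)
  have B0: "inner w (B w) \<ge> 0" if "w \<in> S" for w
  proof (cases "w = 0")
    case False
    have "q ((1 / norm w) *\<^sub>R w) \<le> q v"
      using that False S by (intro max) (auto simp: subspace_scale)
    hence "inner w (A *v w) / (norm w)\<^sup>2 \<le> q v"
      by (simp add: q_def matrix_vector_mult_scaleR power2_eq_square)
    hence "inner w (A *v w) \<le> q v * (norm w)\<^sup>2"
      using False by (simp add: divide_le_eq)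
    thus ?thesis by (simp add: B_def inner_diff_right power2_norm_eq_inner)
  qed (simp add: B_def)
  have sB: "inner u (B w) = inner w (B u)" for u w
    using sa[of u w] by (simp add: B_def inner_diff_right inner_commute)
  have Bv: "inner v (B v) = 0"
    using v by (simp add: B_def q_def inner_diff_right norm_eq_1)
  define w where "w = B v"
  have wS: "w \<in> S" using BS v w_def by blast
  \<comment> \<open>Nonnegativity of the form along the line \<open>v + t *\<^sub>R w\<close>. A
    quadratic in \<open>t\<close> without constant term can be nonnegative everywhere only if its
    linear coefficient vanishes.\<close>
  have quad: "0 \<le> 2 * t * (norm w)\<^sup>2 + t\<^sup>2 * inner w (B w)" for t
  proof -
    have "0 \<le> inner (v + t *\<^sub>R w) (B (v + t *\<^sub>R w))"
      by (intro B0) (use v wS S in \<open>auto intro: subspace_add subspace_scale\<close>)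
    also have "\<dots> = t * inner v (B w) + t * inner w (B v) + t\<^sup>2 * inner w (B w)"
      by (simp add: linB inner_add_left inner_add_right Bv power2_eq_square distrib_left)
    also have "\<dots> = 2 * t * (norm w)\<^sup>2 + t\<^sup>2 * inner w (B w)"
      using sB[of v w] by (simp add: power2_norm_eq_inner w_def)
    finally show ?thesis .
  qed
  have "w = 0"
  proof (rule ccontr)
    assume "w \<noteq> 0"
    define n where "n = (norm w)\<^sup>2"
    define b where "b = inner w (B w)"
    have "n > 0" using \<open>w \<noteq> 0\<close> by (simp add: n_def)
    have "b \<ge> 0" using B0 wS b_def by simp
    \<comment> \<open>At \<open>t = - r\<close> the linear term outweighs the quadratic one; the
      \<open>+ 1\<close> keeps the quotient meaningful for \<open>b = 0\<close>.\<close>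
    define r where "r = n / (b + 1)"
    have n: "n = r * (b + 1)" and "r > 0" using \<open>b \<ge> 0\<close> \<open>n > 0\<close> by (auto simp: r_def)
    have "0 \<le> 2 * (- r) * n + (- r)\<^sup>2 * b"
      using quad[of "- r"] by (simp add: n_def b_def)
    also have "\<dots> = r\<^sup>2 * (- 2 * (b + 1) + b)"
      unfolding n by (simp add: power2_eq_square algebra_simps)
    also have "\<dots> < 0"
      using \<open>b \<ge> 0\<close> \<open>r > 0\<close> by (intro mult_pos_neg) auto
    finally show False by simp
  qed
  hence "A *v v = q v *\<^sub>R v" by (simp add: w_def B_def)
  thus ?thesis using v by blast
qed

text \<open>Each new vector is found in the orthogonal complement of the earlier ones, which
  \<open>A\<close> leaves invariant and which is nonzero by a dimension count.\<close>

lemma hermitian_orthonormal_eigenvectors: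
  fixes A :: "'n::finite op"
  assumes A: "hermitian A" and "k \<le> CARD('n)"
  shows "\<exists>f c. (\<forall>i<k. \<forall>j<k. cinner (f i) (f j) = (if i = j then 1 else 0)) \<and>
    (\<forall>i<k. A *v f i = (c i :: real) *\<^sub>R f i)"
  using assms(2)
proof (induction k)
  case (Suc k)
  have "k \<le> CARD('n)" using Suc.prems by simp
  from Suc.IH[OF this] obtain f c where f: "\<And>i j. i < k \<Longrightarrow> j < k \<Longrightarrow> cinner (f i) (f j) = (if i = j then 1 else 0)"
    and c: "\<And>i. i < k \<Longrightarrow> A *v f i = (c i :: real) *\<^sub>R f i"
    by blast
  define S where "S = {v. \<forall>i<k. cinner (f i) v = 0}"
  have scaleR: "r *\<^sub>R v = complex_of_real r *s v" for r and v :: "complex^'n"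
    by (simp add: vec_eq_iff scaleR_conv_of_real[where 'a=complex])
  have "subspace S"
    by (auto simp: S_def subspace_def cinner_add_right scaleR cinner_scale_right)
       (simp add: cinner_def)
  moreover have "\<exists>v\<in>S. v \<noteq> 0"
  proof -
    \<comment> \<open>Real orthogonality to both \<open>f i\<close> and \<open>\<i> *s f i\<close>
      amounts to complex orthogonality to \<open>f i\<close>. These are at most \<open>2 k\<close>
      vectors in a real space of dimension \<open>2 * CARD('n)\<close>.\<close>
    let ?T = "f ` {..<k} \<union> (\<lambda>i. \<i> *s f i) ` {..<k}"
    have "dim ?T \<le> card ?T" by (intro dim_le_card') auto
    also have "\<dots> \<le> k + k"
      using card_Un_le[of "f ` {..<k}" "(\<lambda>i. \<i> *s f i) ` {..<k}"]
        card_image_le[of "{..<k}" f] card_image_le[of "{..<k}" "\<lambda>i. \<i> *s f i"] by simp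
    also have "\<dots> < DIM(complex^'n)" using Suc.prems by simp
    finally have "dim ?T < DIM(complex^'n)" .
    then obtain x where x: "x \<noteq> 0" "\<And>y. y \<in> span ?T \<Longrightarrow> orthogonal x y"
      using orthogonal_to_subspace_exists by blast
    have "cinner (f i) x = 0" if "i < k" for i
    proof -
      have "inner (f i) x = 0"
        using x(2)[OF span_base, of "f i"] that by (auto simp: orthogonal_def inner_commute)
      moreover have "inner (\<i> *s f i) x = 0"
        using x(2)[OF span_base, of "\<i> *s f i"] that by (auto simp: orthogonal_def inner_commute)
      ultimately show ?thesis
        by (simp add: inner_eq_Re_cinner cinner_scale_left complex_eq_iff)
    qed
    thus ?thesis using x(1) S_def by blast
  qed
  moreover have "A *v v \<in> S" if "v \<in> S" for v
  proof -
    have "cinner (f i) (A *v v) = 0" if "i < k" for i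
      using cinner_dagger[of A "f i" v] A c[OF that] \<open>v \<in> S\<close> that
      by (simp add: hermitian_def scaleR cinner_scale_left S_def)
    thus ?thesis by (simp add: S_def)
  qed
  ultimately obtain v e where v: "v \<in> S" "norm v = 1" "A *v v = (e :: real) *\<^sub>R v"
    using hermitian_eigenvector[OF A] by metis
  have vf: "cinner (f i) v = 0" "cinner v (f i) = 0" if "i < k" for i
    using v(1) that cinner_commute[of v "f i"] by (auto simp: S_def)
  have "cinner v v = 1" using v(2) by (simp add: cinner_self)
  hence "\<forall>i<Suc k. \<forall>j<Suc k. cinner ((f(k := v)) i) ((f(k := v)) j) = (if i = j then 1 else 0)"
    using f vf by (auto simp: less_Suc_eq)
  moreover have "\<forall>i<Suc k. A *v (f(k := v)) i = (c(k := e)) i *\<^sub>R (f(k := v)) i"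
    using c v(3) by (auto simp: less_Suc_eq)
  ultimately show ?case by blast
qed simp

theorem hermitian_diagonalisation:
  fixes A :: "'n::finite op"
  assumes "hermitian A"
  obtains U d where "unitary U" "A = U ** real_diag d ** dagger U"
proof -
  obtain f c where f: "\<And>i j. i < CARD('n) \<Longrightarrow> j < CARD('n) \<Longrightarrow>
      cinner (f i) (f j) = (if i = j then 1 else 0)"
    and c: "\<And>i. i < CARD('n) \<Longrightarrow> A *v f i = (c i :: real) *\<^sub>R f i"
    using hermitian_orthonormal_eigenvectors[OF assms order.refl] by blast
  obtain g :: "'n \<Rightarrow> nat" where g: "bij_betw g UNIV {0..<CARD('n)}"
    using ex_bij_betw_finite_nat[of "UNIV :: 'n set"] by auto
  have gl: "g i < CARD('n)" for i using g by (auto simp: bij_betw_def)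
  have gi: "g i = g j \<longleftrightarrow> i = j" for i j using g by (auto simp: bij_betw_def inj_on_def)
  define U :: "'n op" where "U = (\<chi> i j. f (g j) $ i)"
  have "dagger U ** U = mat 1"
    using f[OF gl gl] by (simp add: vec_eq_iff matrix_matrix_mult_def U_def mat_def cinner_def gi)
  hence U: "unitary U"
    using matrix_left_right_inverse by (auto simp: unitary_def)
  have "A ** U = U ** real_diag (c \<circ> g)"
  proof -
    have "(A ** U) $ i $ j = (A *v f (g j)) $ i" for i j
      by (simp add: matrix_matrix_mult_def matrix_vector_mult_def U_def)
    thus ?thesis
      by (simp add: vec_eq_iff real_diag_right c[OF gl] U_def mult.commute scaleR_conv_of_real[where 'a=complex])
  qed
  hence "A ** U ** dagger U = U ** real_diag (c \<circ> g) ** dagger U" by simp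
  hence "A = U ** real_diag (c \<circ> g) ** dagger U"
    using U by (simp add: unitary_def matrix_mul_assoc[symmetric])
  thus thesis using U that by blast
qed

subsection \<open>Positive operators and the trace norm\<close>

lemma cinner_axis: "cinner (axis i 1) v = v $ i"
proof -
  have "cinner (axis i 1) v = (\<Sum>k\<in>UNIV. if k = i then v $ i else 0)"
    unfolding cinner_def axis_def by (rule sum.cong) auto
  thus ?thesis by simp
qed

lemma matrix_vector_axis: "((A :: complex^'n^'m) *v axis j 1) $ i = A $ i $ j"
proof -
  have "(A *v axis j 1) $ i = (\<Sum>k\<in>UNIV. if k = j then A $ i $ j else 0)"
    unfolding matrix_vector_mult_def axis_def by (simp del: sum.delta sum.delta') (rule sum.cong, auto)
  thus ?thesis by simp
qed

lemma psd_diag: "psd A \<Longrightarrow> A $ i $ i \<in> \<real>\<^sub>\<ge>\<^sub>0"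
  unfolding psd_def by (metis cinner_axis matrix_vector_axis)

text \<open>Polarisation with the test vectors \<open>axis i 1 + c *s axis j 1\<close>: reality of
  the form at \<open>c = 1\<close> and at \<open>c = \<i>\<close> settles the imaginary and the real
  parts of the off-diagonal entries.\<close>

lemma psd_hermitian:
  fixes A :: "'n::finite op"
  assumes "psd A" shows "hermitian A"
proof -
  have 1: "Im (cinner (axis i 1 + c *s axis j 1) (A *v (axis i 1 + c *s axis j 1))) = 0" for i j c
    using assms unfolding psd_def by (auto simp: complex_nonneg_Reals_iff)
  have add: "cinner (u + v) w = cinner u w + cinner v w" for u v w :: "complex^'n"
    by (simp add: cinner_def distrib_right sum.distrib)
  have 2: "Im (A $ i $ i + c * A $ i $ j + cnj c * A $ j $ i + cnj c * c * A $ j $ j) = 0" for i j c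
    using 1[of i c j]
    by (simp add: add cinner_add_right cinner_scale_left cinner_scale_right matrix_vector_right_distrib
        matrix_vector_mult_scale cinner_axis matrix_vector_axis algebra_simps)
  have 3: "Im (A $ i $ i) = 0" for i
    using psd_diag[OF assms, of i] by (simp add: complex_nonneg_Reals_iff)
  have "cnj (A $ j $ i) = A $ i $ j" for i j
    using 2[of i 1 j] 2[of i \<i> j] 3[of i] 3[of j] by (simp add: complex_eq_iff)
  thus ?thesis by (simp add: hermitian_def vec_eq_iff)
qed

lemma psd_trace: assumes "psd A" shows "trace A = of_real (Re (trace A))" "0 \<le> Re (trace A)"
  using psd_diag[OF assms] unfolding trace_def
  by (auto simp: complex_nonneg_Reals_iff complex_eq_iff intro!: sum_nonneg)

lemma psd_add: "psd A \<Longrightarrow> psd B \<Longrightarrow> psd (A + B)"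
  by (simp add: psd_def matrix_vector_mult_add_rdistrib cinner_add_right)

lemma psd_scaleR:
  assumes "psd A" "0 \<le> c" shows "psd (c *\<^sub>R A)"
proof -
  have "cinner v ((c *\<^sub>R A) *v v) = of_real c * cinner v (A *v v)" for v
    by (simp add: cinner_def matrix_vector_mult_def scaleR_conv_of_real[where 'a=complex]
        sum_distrib_left mult_ac)
  thus ?thesis using assms by (auto simp: psd_def intro!: nonneg_Reals_mult_I)
qed

lemma psd_0: "psd 0"
  by (simp add: psd_def cinner_def matrix_vector_mult_def)

lemma psd_sum: "(\<And>i. i \<in> I \<Longrightarrow> psd (f i)) \<Longrightarrow> psd (sum f I)"
  by (induction I rule: infinite_finite_induct) (auto simp: psd_0 psd_add)

lemma trace_scaleR: "trace (c *\<^sub>R (A :: 'n::finite op)) = of_real c * trace A"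
  by (simp add: trace_def sum_distrib_left scaleR_conv_of_real[where 'a=complex])

lemma trace_sum: "trace (\<Sum>i\<in>I. f i) = (\<Sum>i\<in>I. trace (f i :: 'n::finite op))"
  by (simp add: trace_def sum.swap[of _ I])

lemma matrix_mul_scaleR_left: "(A :: 'n::finite op) ** (c *\<^sub>R B) = c *\<^sub>R (A ** B)"
  by (simp add: vec_eq_iff matrix_matrix_mult_def scaleR_sum_right)

lemma unitary_row: assumes "unitary U" shows "(\<Sum>j\<in>UNIV. (cmod (U $ i $ j))\<^sup>2) = 1"
proof -
  have "(U ** dagger U) $ i $ i = 1" using assms by (simp add: unitary_def mat_def)
  hence "(\<Sum>j\<in>UNIV. U $ i $ j * cnj (U $ i $ j)) = 1"
    by (simp add: matrix_matrix_mult_def)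
  hence "complex_of_real (\<Sum>j\<in>UNIV. (cmod (U $ i $ j))\<^sup>2) = of_real 1"
    by (simp only: of_real_sum complex_norm_square of_real_1)
  thus ?thesis using of_real_eq_iff by blast
qed

lemma unitary_column: assumes "unitary U" shows "(\<Sum>i\<in>UNIV. (cmod (U $ i $ j))\<^sup>2) = 1"
  using unitary_row[OF unitary_dagger[OF assms], of j] by simp

lemma unitary_entry: assumes "unitary U" shows "cmod (U $ i $ j) \<le> 1"
proof -
  have "(cmod (U $ i $ j))\<^sup>2 \<le> (\<Sum>j\<in>UNIV. (cmod (U $ i $ j))\<^sup>2)"
    by (rule member_le_sum) auto
  thus ?thesis using unitary_row[OF assms] by (simp add: abs_square_le_1)
qed

lemma unitary_mat_1: "unitary (mat 1)"
  by (simp add: unitary_def)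

text \<open>On hermitian operators \<open>trace_norm\<close> is the Schatten norm with \<open>p = 1\<close>; in the dual form
  it is a seminorm without any appeal to the spectral theorem.\<close>

definition trace_norm :: "'n::finite op \<Rightarrow> real" where
  "trace_norm A = (SUP U\<in>Collect unitary. Re (trace (U ** A)))"

text \<open>Entries of a unitary have modulus at most one, so the sum of the moduli of the entries
  of \<open>A\<close> bounds the set whose supremum is taken.\<close>

lemma trace_norm_upper:
  assumes "unitary U" shows "Re (trace (U ** A)) \<le> trace_norm A"
  unfolding trace_norm_def
proof (rule cSUP_upper)
  show "bdd_above ((\<lambda>U. Re (trace (U ** A))) ` Collect unitary)"
  proof (rule bdd_aboveI2)
    fix U :: "'a op" assume "U \<in> Collect unitary"
    have "Re (trace (U ** A)) \<le> cmod (trace (U ** A))" by (rule complex_Re_le_cmod)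
    also have "\<dots> \<le> (\<Sum>i\<in>UNIV. \<Sum>k\<in>UNIV. cmod (U $ i $ k * A $ k $ i))"
      unfolding trace_def matrix_matrix_mult_def
      by (simp del: norm_mult) (intro order.trans[OF norm_sum] sum_mono order.refl)
    also have "\<dots> \<le> (\<Sum>i\<in>UNIV. \<Sum>k\<in>UNIV. cmod (A $ k $ i))"
      using \<open>U \<in> Collect unitary\<close> unitary_entry
      by (intro sum_mono) (auto simp: norm_mult intro!: mult_left_le_one_le)
    finally show "Re (trace (U ** A)) \<le> (\<Sum>i\<in>UNIV. \<Sum>k\<in>UNIV. cmod (A $ k $ i))" .
  qed
qed (use assms in simp)

lemma trace_norm_least: "(\<And>U. unitary U \<Longrightarrow> Re (trace (U ** A)) \<le> c) \<Longrightarrow> trace_norm A \<le> c"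
  unfolding trace_norm_def using unitary_mat_1 by (intro cSUP_least) auto

lemma trace_norm_triangle: "trace_norm (A + B) \<le> trace_norm A + trace_norm B"
  by (intro trace_norm_least)
     (simp add: matrix_add_ldistrib trace_add add_mono trace_norm_upper)

lemma trace_norm_uminus_le: "trace_norm (- A) \<le> trace_norm A"
proof (rule trace_norm_least)
  fix U :: "'a op" assume "unitary U"
  have "dagger (- U) = - dagger U" "- X ** - Y = X ** Y" for X Y :: "'a op"
    by (simp_all add: vec_eq_iff matrix_matrix_mult_def)
  hence "unitary (- U)"
    using \<open>unitary U\<close> by (simp add: unitary_def)
  moreover have "U ** - A = - U ** A"
    by (simp add: vec_eq_iff matrix_matrix_mult_def)
  ultimately show "Re (trace (U ** - A)) \<le> trace_norm A"
    using trace_norm_upper by metis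
qed

lemma trace_norm_uminus: "trace_norm (- A) = trace_norm A"
  using trace_norm_uminus_le[of A] trace_norm_uminus_le[of "- A"] by simp

lemma trace_norm_minus_commute: "trace_norm (A - B) = trace_norm (B - A)"
  using trace_norm_uminus[of "A - B"] by simp

lemma trace_norm_0 [simp]: "trace_norm 0 = 0"
proof -
  have "U ** 0 = 0" for U :: "'a op" by (simp add: vec_eq_iff matrix_matrix_mult_def)
  hence "trace (U ** 0) = 0" for U :: "'a op" by (simp add: trace_def)
  thus ?thesis
    using trace_norm_least[of "0 :: 'a op" 0] trace_norm_upper[OF unitary_mat_1, of 0]
    by (metis order.antisym order.refl zero_complex.sel(1))
qed

lemma trace_norm_nonneg: "0 \<le> trace_norm A"
  using trace_norm_triangle[of A "- A"] by (simp add: trace_norm_uminus)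

lemma trace_norm_scaleR_le: "0 \<le> c \<Longrightarrow> trace_norm (c *\<^sub>R A) \<le> c * trace_norm A"
  by (intro trace_norm_least)
     (simp add: matrix_mul_scaleR_left trace_scaleR mult_left_mono trace_norm_upper)

lemma trace_norm_scaleR: "trace_norm (c *\<^sub>R A) = \<bar>c\<bar> * trace_norm A"
proof -
  have pos: "trace_norm (c *\<^sub>R A) = c * trace_norm A" if "c > 0" for c
    using trace_norm_scaleR_le[of c A] trace_norm_scaleR_le[of "1 / c" "c *\<^sub>R A"] that
    by (simp add: field_simps)
  consider "c = 0" | "c > 0" | "c < 0" by linarith
  thus ?thesis
  proof cases
    case 3
    thus ?thesis using pos[of "- c"] trace_norm_uminus[of "c *\<^sub>R A"] by simp
  qed (use pos in auto)
qed

lemma trace_norm_sum: "trace_norm (\<Sum>i\<in>I. f i) \<le> (\<Sum>i\<in>I. trace_norm (f i))"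
  by (induction I rule: infinite_finite_induct)
     (auto intro: order.trans[OF trace_norm_triangle])

lemma trace_norm_diff: "trace_norm (A - B) \<le> trace_norm A + trace_norm B"
  using trace_norm_triangle[of A "- B"] by (simp add: trace_norm_uminus)

lemma hermitian_diff: "hermitian A \<Longrightarrow> hermitian B \<Longrightarrow> hermitian (A - B)"
  by (simp add: hermitian_def dagger_diff)

lemma trace_similar:
  assumes "unitary U" shows "trace (dagger U ** A ** U) = trace A"
proof -
  have "trace (dagger U ** A ** U) = trace (U ** (dagger U ** A))"
    by (rule trace_mul_sym)
  thus ?thesis using assms by (simp add: matrix_mul_assoc unitary_def)
qed

text \<open>Both norms equal the sum of the absolute eigenvalues. The supremum over unitaries does
  not exceed it, because a unitary has diagonal entries bounded by one in the eigenbasis too, and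
  the sign of \<open>H\<close> attains it.\<close>

lemma hermitian_norm_1:
  fixes H :: "'n::finite op"
  assumes "hermitian H"
  shows "schatten_norm 1 H = trace_norm H"
    and "\<exists>U. unitary U \<and> trace_norm H = Re (trace (U ** H))"
proof -
  obtain U d where U: "unitary U" and H: "H = U ** real_diag d ** dagger U"
    using hermitian_diagonalisation[OF assms] .
  have UU: "dagger U ** (U ** X) = X" for X :: "'n op"
    using U by (simp add: matrix_mul_assoc unitary_def)
  have tr: "trace (U ** real_diag e ** dagger U) = of_real (\<Sum>i\<in>UNIV. e i)" for e
    using trace_similar[OF unitary_dagger[OF U], of "real_diag e"]
    by (simp add: trace_def real_diag_def)
  have mult: "U ** real_diag e ** dagger U ** H = U ** real_diag (\<lambda>i. e i * d i) ** dagger U" for e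
    unfolding H by (simp add: matrix_mul_assoc[symmetric] UU) (simp add: matrix_mul_assoc real_diag_mult)
  have "dagger H ** H = U ** real_diag (\<lambda>i. d i * d i) ** dagger U"
    using mult[of d] assms by (simp add: hermitian_def H[symmetric])
  moreover have "(x * x) powr (1 / 2) = \<bar>x\<bar>" for x :: real
    by (simp add: powr_half_sqrt)
  ultimately have S: "schatten_norm 1 H = (\<Sum>i\<in>UNIV. \<bar>d i\<bar>)"
    by (simp add: schatten_norm_def op_powr_def spectral_fun_eq[OF U] tr sum_nonneg)
  \<comment> \<open>The sign of \<open>H\<close>, with value 1 on the kernel, where 0 would destroy
    unitarity.\<close>
  define V where "V = U ** real_diag (\<lambda>i. if d i < 0 then -1 else 1) ** dagger U"
  have "real_diag (\<lambda>i. if d i < 0 then -1 else 1) ** real_diag (\<lambda>i. if d i < 0 then -1 else 1) = mat 1"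
    unfolding real_diag_mult real_diag_1[symmetric] by (rule arg_cong[where f=real_diag]) auto
  hence V: "unitary V"
    unfolding V_def using U
    by (intro unitary_mult unitary_dagger) (auto simp: unitary_def)
  have "Re (trace (V ** H)) = (\<Sum>i\<in>UNIV. \<bar>d i\<bar>)"
    unfolding V_def mult tr by (simp add: abs_if) (rule sum.cong, auto)
  moreover have "trace_norm H \<le> (\<Sum>i\<in>UNIV. \<bar>d i\<bar>)"
  proof (rule trace_norm_least)
    fix W :: "'n op" assume "unitary W"
    define X where "X = dagger U ** W ** U"
    have "unitary X"
      unfolding X_def using U \<open>unitary W\<close> by (intro unitary_mult unitary_dagger)
    have "trace (W ** H) = trace (dagger U ** (W ** H) ** U)"
      by (rule trace_similar[OF U, symmetric])
    also have "dagger U ** (W ** H) ** U = X ** real_diag d"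
      unfolding H X_def using U by (simp add: unitary_def matrix_mul_assoc[symmetric])
    finally have "Re (trace (W ** H)) = (\<Sum>i\<in>UNIV. Re (X $ i $ i) * d i)"
      by (simp add: trace_def real_diag_right)
    also have "\<dots> \<le> (\<Sum>i\<in>UNIV. \<bar>d i\<bar>)"
    proof (rule sum_mono)
      fix i
      have "\<bar>Re (X $ i $ i)\<bar> \<le> 1"
        using unitary_entry[OF \<open>unitary X\<close>, of i i] abs_Re_le_cmod order.trans by blast
      hence "\<bar>Re (X $ i $ i)\<bar> * \<bar>d i\<bar> \<le> \<bar>d i\<bar>"
        by (simp add: mult_left_le_one_le)
      thus "Re (X $ i $ i) * d i \<le> \<bar>d i\<bar>"
        using abs_ge_self[of "Re (X $ i $ i) * d i"] by (simp add: abs_mult)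
    qed
    finally show "Re (trace (W ** H)) \<le> (\<Sum>i\<in>UNIV. \<bar>d i\<bar>)" .
  qed
  ultimately show "schatten_norm 1 H = trace_norm H"
      "\<exists>U. unitary U \<and> trace_norm H = Re (trace (U ** H))"
    using trace_norm_upper[OF V, of H] S V by (auto intro!: exI[of _ V])
qed

subsection \<open>The Hilbert-Schmidt norm\<close>

text \<open>The type class norm of nested vectors is the Hilbert-Schmidt norm, so operators already
  form the real inner product space in which second moments are taken.\<close>

lemma norm_op_square: "(norm (A :: complex^'n^'m))\<^sup>2 = (\<Sum>i\<in>UNIV. \<Sum>j\<in>UNIV. (cmod (A $ i $ j))\<^sup>2)"
  by (simp add: norm_vec_def L2_set_def sum_nonneg)

lemma norm_op_square_trace: "(norm (A :: 'n::finite op))\<^sup>2 = Re (trace (dagger A ** A))"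
proof -
  have "Re (cnj z * z) = (cmod z)\<^sup>2" for z
    using cmod_power2[of z] by (simp add: power2_eq_square)
  hence "Re (trace (dagger A ** A)) = (\<Sum>j\<in>UNIV. \<Sum>i\<in>UNIV. (cmod (A $ i $ j))\<^sup>2)"
    by (simp add: trace_def matrix_matrix_mult_def)
  also have "\<dots> = (norm A)\<^sup>2" unfolding norm_op_square by (rule sum.swap)
  finally show ?thesis by simp
qed

lemma norm_unitary_left:
  assumes "unitary U" shows "norm (U ** A) = norm (A :: 'n::finite op)"
proof -
  have "dagger (U ** A) ** (U ** A) = dagger A ** (dagger U ** U) ** A"
    by (simp add: dagger_mult matrix_mul_assoc)
  hence "(norm (U ** A))\<^sup>2 = (norm A)\<^sup>2"
    using assms by (simp add: norm_op_square_trace unitary_def)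
  thus ?thesis by simp
qed

lemma norm_unitary_right:
  assumes "unitary U" shows "norm (A ** U) = norm (A :: 'n::finite op)"
proof -
  have "dagger (A ** U) ** (A ** U) = dagger U ** (dagger A ** A) ** U"
    by (simp add: dagger_mult matrix_mul_assoc)
  hence "(norm (A ** U))\<^sup>2 = (norm A)\<^sup>2"
    using trace_similar[OF assms] by (simp add: norm_op_square_trace)
  thus ?thesis by simp
qed

lemma psd_gram: "psd (dagger A ** A)"
proof -
  have "cinner v ((dagger A ** A) *v v) = of_real ((norm (A *v v))\<^sup>2)" for v
    using cinner_dagger[of A "A *v v" v] cinner_dagger[of "dagger A" v "A *v v"]
    by (simp add: matrix_vector_mul_assoc[symmetric] cinner_self)
  thus ?thesis by (simp add: psd_def)
qed

lemma psd_eigenvalues: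
  assumes "psd (U ** real_diag d ** dagger U)" "unitary U" shows "0 \<le> d i"
proof -
  have "cinner (U *v axis i 1) ((U ** real_diag d ** dagger U) *v (U *v axis i 1)) =
      cinner (axis i 1) ((dagger U ** (U ** real_diag d ** dagger U) ** U) *v axis i 1)"
    using cinner_dagger[of "dagger U" "axis i 1"] by (simp add: matrix_vector_mul_assoc[symmetric])
  also have "dagger U ** (U ** real_diag d ** dagger U) ** U =
      (dagger U ** U) ** real_diag d ** (dagger U ** U)"
    by (simp add: matrix_mul_assoc)
  also have "\<dots> = real_diag d" using assms by (simp add: unitary_def)
  finally show ?thesis
    using assms(1)[unfolded psd_def, rule_format, of "U *v axis i 1"]
    by (simp add: cinner_axis matrix_vector_axis) (simp add: real_diag_def)
qed

lemma schatten_norm_2: "schatten_norm 2 A = norm (A :: 'n::finite op)"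
proof -
  obtain U d where U: "unitary U" and H: "dagger A ** A = U ** real_diag d ** dagger U"
    using hermitian_diagonalisation[OF psd_hermitian[OF psd_gram]] .
  \<comment> \<open>\<open>x powr 1 = x\<close> holds exactly for \<open>0 \<le> x\<close>, hence
    the appeal to the nonnegative spectrum of the Gram operator.\<close>
  have "0 \<le> d i" for i using psd_eigenvalues U H psd_gram by metis
  hence "op_powr (dagger A ** A) 1 = dagger A ** A"
    unfolding H op_powr_def spectral_fun_eq[OF U] by simp
  thus ?thesis
    by (simp add: schatten_norm_def norm_op_square_trace[symmetric] powr_half_sqrt)
qed

text \<open>\<open>weighted V e A\<close> is \<open>\<beta>\<^sup>-\<^sup>1\<^sup>/\<^sup>4 A \<beta>\<^sup>-\<^sup>1\<^sup>/\<^sup>4\<close> in the eigenbasis of \<open>\<beta> = V ** real_diag e ** dagger V\<close>.\<close>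

definition weighted :: "'n::finite op \<Rightarrow> ('n \<Rightarrow> real) \<Rightarrow> 'n op \<Rightarrow> 'n op" where
  "weighted V e A = real_diag (\<lambda>i. e i powr (-1/4)) ** (dagger V ** A ** V) **
     real_diag (\<lambda>i. e i powr (-1/4))"

text \<open>For unitary \<open>V\<close> and hermitian \<open>A\<close> this says that the support
  of \<open>A\<close> lies in that of \<open>V ** real_diag e ** dagger V\<close>. In this form the
  condition is linear in \<open>A\<close> and survives averaging.\<close>

definition supported :: "'n::finite op \<Rightarrow> ('n \<Rightarrow> real) \<Rightarrow> 'n op \<Rightarrow> bool" where
  "supported V e A \<longleftrightarrow> (\<forall>k l. e k = 0 \<or> e l = 0 \<longrightarrow> (dagger V ** A ** V) $ k $ l = 0)"

lemma weighted_nth: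
  "weighted V e A $ k $ l = of_real (e k powr (-1/4) * e l powr (-1/4)) * (dagger V ** A ** V) $ k $ l"
  by (simp add: weighted_def real_diag_left real_diag_right mult_ac)

lemma similar_linear: "linear (\<lambda>A. dagger V ** A ** (V :: 'n::finite op))"
  by (rule linearI) (simp_all add: vec_eq_iff matrix_matrix_mult_def sum_distrib_left sum_distrib_right
      distrib_left distrib_right sum.distrib scaleR_sum_right)

lemma weighted_linear: "linear (weighted V e)"
  by (intro linearI)
     (simp_all add: vec_eq_iff weighted_nth linear_add[OF similar_linear] linear_scale[OF similar_linear]
       distrib_left)

lemma supported_scaleR: "supported V e A \<Longrightarrow> supported V e (c *\<^sub>R A)"
  unfolding supported_def by (simp add: linear_scale[OF similar_linear])

text \<open>A linearised Cauchy-Schwarz inequality. With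
  \<open>\<beta> = V ** real_diag e ** dagger V\<close>, undoing the weights writes \<open>A\<close>
  as \<open>\<beta>^(1/4) Y \<beta>^(1/4)\<close>, and the trace against a unitary is estimated
  entry by entry. Rows and columns of a unitary have unit length, so the eigenvalues add up to the
  trace of \<open>\<beta>\<close>.\<close>

lemma trace_norm_le_weighted:
  assumes V: "unitary V" and e: "\<And>i. 0 \<le> e i" and A: "supported V e A" and "0 < \<epsilon>"
  shows "trace_norm A \<le> (\<epsilon> * (\<Sum>i\<in>UNIV. e i) + (norm (weighted V e A))\<^sup>2 / \<epsilon>) / 2"
proof (rule trace_norm_least)
  fix U :: "'a op" assume "unitary U"
  define W where "W = dagger V ** U ** V"
  define B where "B = dagger V ** A ** V"
  have W: "unitary W"
    unfolding W_def using V \<open>unitary U\<close> by (intro unitary_mult unitary_dagger)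
  have "dagger V ** (U ** A) ** V = dagger V ** U ** (V ** dagger V) ** A ** V"
    using V by (simp add: unitary_def matrix_mul_assoc)
  hence "trace (U ** A) = trace (W ** B)"
    using trace_similar[OF V, of "U ** A"] by (simp add: W_def B_def matrix_mul_assoc)
  hence "Re (trace (U ** A)) = (\<Sum>i\<in>UNIV. \<Sum>k\<in>UNIV. Re (W $ i $ k * B $ k $ i))"
    by (simp add: trace_def matrix_matrix_mult_def)
  also have "\<dots> \<le> (\<Sum>i\<in>UNIV. \<Sum>k\<in>UNIV. (\<epsilon> * ((cmod (W $ i $ k))\<^sup>2 * e k + (cmod (W $ i $ k))\<^sup>2 * e i) / 2
      + (cmod (weighted V e A $ k $ i))\<^sup>2 / \<epsilon>) / 2)"
  proof (intro sum_mono)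
    fix i k
    define r where "r = e k powr (1/4) * e i powr (1/4)"
    define x where "x = cmod (W $ i $ k)"
    define y where "y = cmod (weighted V e A $ k $ i)"
    have y0: "y \<ge> 0" by (simp add: y_def)
    have "(a powr (1/4))\<^sup>2 = sqrt a" if "a \<ge> 0" for a :: real
      using that by (simp add: powr_half_sqrt[symmetric] power2_eq_square powr_add[symmetric])
    hence "r\<^sup>2 = sqrt (e k) * sqrt (e i)"
      using e by (simp add: r_def power_mult_distrib)
    \<comment> \<open>The product of two eigenvalues would tie rows to columns; the arithmetic mean
      lets row sums and column sums be used separately.\<close>
    hence r2: "r\<^sup>2 \<le> (e k + e i) / 2"
      using arith_geo_mean_sqrt[OF e[of k] e[of i]] by (simp add: real_sqrt_mult)
    \<comment> \<open>On the kernel both sides are 0: the left one by \<open>supported\<close>, the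
      right one because \<open>0 powr s = 0\<close>.\<close>
    have "cmod (B $ k $ i) = r * y"
    proof (cases "e k = 0 \<or> e i = 0")
      case True
      thus ?thesis using A by (auto simp: supported_def B_def r_def)
    next
      case False
      have inv: "a powr (1/4) * a powr - (1/4) = 1" if "a \<noteq> 0" "a \<ge> 0" for a :: real
        using that by (simp add: powr_add[symmetric])
      have "r * y = (e k powr (1/4) * e k powr (-1/4)) * (e i powr (1/4) * e i powr (-1/4)) * cmod (B $ k $ i)"
        by (simp add: y_def r_def weighted_nth norm_mult B_def mult_ac)
      thus ?thesis using False e by (simp add: inv)
    qed
    hence "Re (W $ i $ k * B $ k $ i) \<le> x * (r * y)"
      using complex_Re_le_cmod[of "W $ i $ k * B $ k $ i"] by (simp add: norm_mult x_def)
    also have "x * (r * y) \<le> (\<epsilon> * (x * r)\<^sup>2 + y\<^sup>2 / \<epsilon>) / 2"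
    proof -
      have "0 \<le> (\<epsilon> * (x * r) - y)\<^sup>2 / \<epsilon>" using \<open>0 < \<epsilon>\<close> by simp
      also have "\<dots> = \<epsilon> * (x * r)\<^sup>2 + y\<^sup>2 / \<epsilon> - 2 * (x * (r * y))"
        using \<open>0 < \<epsilon>\<close> by (simp add: power2_diff field_simps power2_eq_square)
      finally show ?thesis by simp
    qed
    also have "\<dots> \<le> (\<epsilon> * (x\<^sup>2 * ((e k + e i) / 2)) + y\<^sup>2 / \<epsilon>) / 2"
      using r2 \<open>0 < \<epsilon>\<close> by (simp add: power_mult_distrib mult_left_mono)
    finally show "Re (W $ i $ k * B $ k $ i) \<le>
      (\<epsilon> * ((cmod (W $ i $ k))\<^sup>2 * e k + (cmod (W $ i $ k))\<^sup>2 * e i) / 2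
      + (cmod (weighted V e A $ k $ i))\<^sup>2 / \<epsilon>) / 2"
      by (simp add: x_def y_def algebra_simps)
  qed
  also have "\<dots> = (\<epsilon> * ((\<Sum>i\<in>UNIV. \<Sum>k\<in>UNIV. (cmod (W $ i $ k))\<^sup>2 * e k) +
      (\<Sum>i\<in>UNIV. \<Sum>k\<in>UNIV. (cmod (W $ i $ k))\<^sup>2 * e i)) / 2
      + (\<Sum>i\<in>UNIV. \<Sum>k\<in>UNIV. (cmod (weighted V e A $ k $ i))\<^sup>2) / \<epsilon>) / 2"
    by (simp add: sum.distrib sum_distrib_left sum_divide_distrib add_divide_distrib distrib_left)
  also have "(\<Sum>i\<in>UNIV. \<Sum>k\<in>UNIV. (cmod (W $ i $ k))\<^sup>2 * e k) = (\<Sum>i\<in>UNIV. e i)"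
    by (subst sum.swap) (simp add: sum_distrib_right[symmetric] unitary_column[OF W])
  also have "(\<Sum>i\<in>UNIV. \<Sum>k\<in>UNIV. (cmod (W $ i $ k))\<^sup>2 * e i) = (\<Sum>i\<in>UNIV. e i)"
    by (simp add: sum_distrib_right[symmetric] unitary_row[OF W])
  also have "(\<Sum>i\<in>UNIV. \<Sum>k\<in>UNIV. (cmod (weighted V e A $ k $ i))\<^sup>2) = (norm (weighted V e A))\<^sup>2"
    unfolding norm_op_square by (rule sum.swap)
  finally show "Re (trace (U ** A)) \<le> (\<epsilon> * (\<Sum>i\<in>UNIV. e i) + (norm (weighted V e A))\<^sup>2 / \<epsilon>) / 2"
    by simp
qed

subsection \<open>Classical-quantum operators\<close>

lemma sum_in_nonneg_Reals: "(\<And>i. i \<in> I \<Longrightarrow> f i \<in> \<real>\<^sub>\<ge>\<^sub>0) \<Longrightarrow> sum f I \<in> \<real>\<^sub>\<ge>\<^sub>0"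
  by (induction I rule: infinite_finite_induct) (auto intro: nonneg_Reals_add_I)

lemma sum_prod_UNIV:
  fixes f :: "'a::finite \<times> 'b::finite \<Rightarrow> 'c::comm_monoid_add"
  shows "(\<Sum>p\<in>UNIV. f p) = (\<Sum>a\<in>UNIV. \<Sum>b\<in>UNIV. f (a, b))"
  by (simp add: sum.cartesian_product UNIV_Times_UNIV[symmetric] del: UNIV_Times_UNIV)

section \<open>Tensor products of operators\<close>

lemma tensor_mult: "tensor A B ** tensor C D = tensor (A ** C) (B ** D)"
  by (simp add: vec_eq_iff matrix_matrix_mult_def tensor_def sum_prod_UNIV sum_product mult_ac)

lemma dagger_tensor: "dagger (tensor A B) = tensor (dagger A) (dagger B)"
  by (simp add: vec_eq_iff tensor_def)

lemma tensor_real_diag: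
  "tensor (real_diag b) (real_diag d) = real_diag (\<lambda>p. b (fst p) * d (snd p))"
  by (auto simp: vec_eq_iff tensor_def real_diag_def prod_eq_iff)

lemma tensor_mat_1: "tensor (mat 1) (mat 1) = mat 1"
  using tensor_real_diag[of "\<lambda>_. 1" "\<lambda>_. 1"] by (simp add: real_diag_1)

lemma unitary_tensor: "unitary U \<Longrightarrow> unitary V \<Longrightarrow> unitary (tensor U V)"
  by (simp add: unitary_def dagger_tensor tensor_mult tensor_mat_1)

lemma trace_tensor: "trace (tensor A B) = trace A * trace B"
  by (simp add: trace_def tensor_def sum_prod_UNIV sum_product)

text \<open>Diagonalise \<open>B\<close> and apply positivity of \<open>A\<close> to each slice of the rotated vector.\<close>

lemma psd_tensor:
  fixes A :: "'a::finite op" and B :: "'b::finite op"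
  assumes A: "psd A" and B: "psd B" shows "psd (tensor A B)"
  unfolding psd_def
proof
  fix v
  obtain U d where U: "unitary U" and BU: "B = U ** real_diag d ** dagger U"
    using hermitian_diagonalisation[OF psd_hermitian[OF B]] .
  have d: "0 \<le> d k" for k using psd_eigenvalues[of U d k] B U BU by simp
  define T :: "('a \<times> 'b) op" where "T = tensor (mat 1) U"
  have "tensor A B = T ** tensor A (real_diag d) ** dagger T"
    by (simp add: T_def dagger_tensor tensor_mult BU)
  hence "cinner v (tensor A B *v v) = cinner (dagger T *v v) (tensor A (real_diag d) *v (dagger T *v v))"
    using cinner_dagger[of "dagger T" v] by (simp add: matrix_vector_mul_assoc[symmetric] cinner_dagger)
  also have "\<dots> = (\<Sum>k\<in>UNIV. of_real (d k) * cinner (\<chi> i. (dagger T *v v) $ (i, k))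
      (A *v (\<chi> i. (dagger T *v v) $ (i, k))))" (is "_ = ?R")
  proof -
    define u where "u = dagger T *v v"
    have "(tensor A (real_diag d) *v u) $ (i, k) = of_real (d k) * (A *v (\<chi> i. u $ (i, k))) $ i" for i k
    proof -
      have "(tensor A (real_diag d) *v u) $ (i, k) =
          (\<Sum>j\<in>UNIV. \<Sum>l\<in>UNIV. if l = k then of_real (d k) * (A $ i $ j * u $ (j, k)) else 0)"
        unfolding matrix_vector_mult_def tensor_def real_diag_def
        by (simp del: sum.delta sum.delta' add: sum_prod_UNIV) (intro sum.cong, auto)
      thus ?thesis by (simp add: matrix_vector_mult_def sum_distrib_left)
    qed
    hence "cinner u (tensor A (real_diag d) *v u) =
        (\<Sum>i\<in>UNIV. \<Sum>k\<in>UNIV. of_real (d k) * (cnj (u $ (i, k)) * (A *v (\<chi> i. u $ (i, k))) $ i))"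
      by (simp add: cinner_def sum_prod_UNIV mult_ac)
    also have "\<dots> = (\<Sum>k\<in>UNIV. of_real (d k) * cinner (\<chi> i. u $ (i, k)) (A *v (\<chi> i. u $ (i, k))))"
      by (subst sum.swap) (simp add: cinner_def sum_distrib_left)
    finally show ?thesis by (simp add: u_def)
  qed
  also have "?R \<in> \<real>\<^sub>\<ge>\<^sub>0"
    by (intro sum_in_nonneg_Reals nonneg_Reals_mult_I) (use A d in \<open>auto simp: psd_def\<close>)
  finally show "cinner v (tensor A B *v v) \<in> \<real>\<^sub>\<ge>\<^sub>0" .
qed

section \<open>Diagonal blocks and marginals of classical-quantum operators\<close>

definition block :: "('w::finite \<times> 'e::finite) op \<Rightarrow> 'w \<Rightarrow> 'e op" where
  "block A v = (\<chi> k l. A $ (v, k) $ (v, l))"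

lemma block_nth [simp]: "block A v $ k $ l = A $ (v, k) $ (v, l)"
  by (simp add: block_def)

lemma block_diff: "block (A - B) v = block A v - block B v"
  by (simp add: vec_eq_iff)

lemma hermitian_block:
  assumes "hermitian A" shows "hermitian (block A v)"
proof -
  have "cnj (A $ p $ q) = A $ q $ p" for p q
    using assms unfolding hermitian_def by (metis dagger_nth)
  thus ?thesis by (simp add: hermitian_def vec_eq_iff)
qed

lemma tensor_mat_1_left_nth:
  "(tensor (mat 1) B ** A) $ (v, k) $ q = (\<Sum>l\<in>UNIV. B $ k $ l * A $ (v, l) $ q)"
proof -
  have "(tensor (mat 1) B ** A) $ (v, k) $ q =
      (\<Sum>u\<in>UNIV. if u = v then \<Sum>l\<in>UNIV. B $ k $ l * A $ (v, l) $ q else 0)"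
    unfolding matrix_matrix_mult_def tensor_def mat_def
    by (simp del: sum.delta sum.delta' add: sum_prod_UNIV) (intro sum.cong, auto)
  thus ?thesis by simp
qed

lemma tensor_mat_1_right_nth:
  "(A ** tensor (mat 1) B) $ q $ (v, k) = (\<Sum>l\<in>UNIV. A $ q $ (v, l) * B $ l $ k)"
proof -
  have "(A ** tensor (mat 1) B) $ q $ (v, k) =
      (\<Sum>u\<in>UNIV. if u = v then \<Sum>l\<in>UNIV. A $ q $ (v, l) * B $ l $ k else 0)"
    unfolding matrix_matrix_mult_def tensor_def mat_def
    by (simp del: sum.delta sum.delta' add: sum_prod_UNIV) (intro sum.cong, auto)
  thus ?thesis by simp
qed

lemma block_similar:
  "block (dagger (tensor (mat 1) V) ** A ** tensor (mat 1) V) v = dagger V ** block A v ** V"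
  by (simp add: vec_eq_iff dagger_tensor tensor_mat_1_right_nth tensor_mat_1_left_nth)
     (simp add: matrix_matrix_mult_def)

text \<open>The block-diagonal sum of optimal unitaries is unitary.\<close>

lemma trace_norm_pinching:
  fixes A :: "('w::finite \<times> 'e::finite) op"
  assumes "hermitian A"
  shows "(\<Sum>v\<in>UNIV. trace_norm (block A v)) \<le> trace_norm A"
proof -
  obtain U where U: "\<And>v. unitary (U v)" "\<And>v. trace_norm (block A v) = Re (trace (U v ** block A v))"
    using hermitian_norm_1(2)[OF hermitian_block[OF assms]] by metis
  define W :: "('w \<times> 'e) op" where
    "W = (\<chi> p q. if fst p = fst q then U (fst p) $ snd p $ snd q else 0)"
  have left: "(W ** B) $ (v, k) $ q = (\<Sum>l\<in>UNIV. U v $ k $ l * B $ (v, l) $ q)" for B v k q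
  proof -
    have "(W ** B) $ (v, k) $ q = (\<Sum>u\<in>UNIV. if u = v then \<Sum>l\<in>UNIV. U v $ k $ l * B $ (v, l) $ q else 0)"
      unfolding matrix_matrix_mult_def W_def
      by (simp del: sum.delta sum.delta' add: sum_prod_UNIV) (intro sum.cong, auto)
    thus ?thesis by simp
  qed
  have "W ** dagger W = mat 1"
  proof -
    have "(\<Sum>l\<in>UNIV. U v $ k $ l * cnj (U v $ k' $ l)) = (if k = k' then 1 else 0)" for v k k'
    proof -
      have "(U v ** dagger (U v)) $ k $ k' = (mat 1 :: 'e op) $ k $ k'"
        using U(1)[of v] by (simp add: unitary_def)
      thus ?thesis by (simp add: matrix_matrix_mult_def mat_def)
    qed
    moreover have "W $ (v, k) $ (v', l) = (if v = v' then U v $ k $ l else 0)" for v k v' l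
      by (simp add: W_def)
    ultimately have "(W ** dagger W) $ (v, k) $ (v', k') = mat 1 $ (v, k) $ (v', k')" for v k v' k'
      by (cases "v = v'") (simp_all add: left mat_def)
    thus ?thesis by (simp add: vec_eq_iff)
  qed
  hence W: "unitary W" using matrix_left_right_inverse by (auto simp: unitary_def)
  have "Re (trace (W ** A)) = (\<Sum>v\<in>UNIV. Re (trace (U v ** block A v)))"
    by (simp add: trace_def sum_prod_UNIV left) (simp add: matrix_matrix_mult_def)
  thus ?thesis using trace_norm_upper[OF W, of A] U(2) by simp
qed

lemma sum_fibres:
  fixes f :: "'z::finite \<Rightarrow> 'v::comm_monoid_add"
  shows "(\<Sum>v\<in>(UNIV :: 'w::finite set). \<Sum>z | w z = v. f z) = (\<Sum>z\<in>UNIV. f z)"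
  using sum.group[of "UNIV :: 'z set" "UNIV :: 'w set" w f] by simp

text \<open>\<open>w\<close> need not be injective: letters with the same label share a block, so
  states with some classical systems traced out are covered as well.\<close>

lemma block_cq:
  fixes s :: "'z::finite \<Rightarrow> 'e::finite op" and w :: "'z \<Rightarrow> 'w::finite"
  shows "(\<Sum>z\<in>UNIV. c z *\<^sub>R tensor (basis_proj (w z)) (s z)) $ (u, k) $ (v, l) =
    (if u = v then (\<Sum>z | w z = v. c z *\<^sub>R s z) $ k $ l else 0)"
proof -
  have "(\<Sum>z\<in>UNIV. c z *\<^sub>R tensor (basis_proj (w z)) (s z)) $ (u, k) $ (v, l) =
      (\<Sum>z\<in>UNIV. if w z = v then if u = v then (c z *\<^sub>R s z) $ k $ l else 0 else 0)"
    by (simp add: tensor_def basis_proj_def) (intro sum.cong, auto)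
  also have "\<dots> = (\<Sum>z | w z = v. if u = v then (c z *\<^sub>R s z) $ k $ l else 0)"
    by (simp add: sum.inter_filter[symmetric])
  finally show ?thesis by simp
qed

lemma ptrace_cq_quantum:
  fixes w :: "'z::finite \<Rightarrow> 'w::finite"
  shows "ptrace (\<lambda>(e, w). (w, e)) (\<Sum>z\<in>UNIV. c z *\<^sub>R tensor (basis_proj (w z)) (s z)) = (\<Sum>z\<in>UNIV. c z *\<^sub>R s z)"
proof -
  have "(\<Sum>v\<in>UNIV. (\<Sum>z\<in>UNIV. c z *\<^sub>R tensor (basis_proj (w z)) (s z)) $ (v, k) $ (v, l)) =
      (\<Sum>z\<in>UNIV. c z *\<^sub>R s z) $ k $ l" for k l
    using arg_cong[OF sum_fibres[of "\<lambda>z. c z *\<^sub>R s z" w], of "\<lambda>A. A $ k $ l"]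
    by (simp only: block_cq) simp
  thus ?thesis by (simp add: vec_eq_iff ptrace_def)
qed

subsection \<open>Extracting an operator ensemble from the smooth mutual information\<close>

lemma op_powr_eq:
  "unitary U \<Longrightarrow> op_powr (U ** real_diag d ** dagger U) x = U ** real_diag (\<lambda>i. d i powr x) ** dagger U"
  by (simp add: op_powr_def spectral_fun_eq)

text \<open>The columns of the rotated \<open>\<alpha>\<close> lie in the range of
  \<open>real_diag d\<close>, whose \<open>p\<close>-th coordinate is 0.\<close>

lemma supp_subset_similar_row:
  assumes "supp \<alpha> \<subseteq> supp (U ** real_diag d ** dagger U)" "unitary U" "d p = 0"
  shows "(dagger U ** \<alpha> ** U) $ p $ q = 0"
proof -
  obtain u where u: "\<alpha> *v (U *v axis q 1) = (U ** real_diag d ** dagger U) *v u"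
    using assms(1) by (auto simp: supp_def)
  have "(dagger U ** \<alpha> ** U) *v axis q 1 = dagger U *v (\<alpha> *v (U *v axis q 1))"
    by (simp add: matrix_vector_mul_assoc matrix_mul_assoc)
  also have "\<dots> = ((dagger U ** U) ** real_diag d ** dagger U) *v u"
    unfolding u by (simp add: matrix_vector_mul_assoc matrix_mul_assoc)
  also have "\<dots> = real_diag d *v (dagger U *v u)"
    using assms(2) by (simp add: unitary_def matrix_vector_mul_assoc)
  finally have "(dagger U ** \<alpha> ** U) $ p $ q = (real_diag d *v (dagger U *v u)) $ p"
    by (metis matrix_vector_axis)
  also have "\<dots> = 0"
    using assms(3) by (simp add: matrix_vector_mult_def real_diag_def if_distrib[of "\<lambda>x. x * _"] cong: if_cong)
  finally show ?thesis .
qed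

lemma D2_lessD:
  assumes "D2 \<alpha> \<beta> < ereal (log 2 c)" "0 < c"
  shows "supp \<alpha> \<subseteq> supp \<beta>"
    and "(norm (op_powr \<beta> (- 1/4) ** \<alpha> ** op_powr \<beta> (- 1/4)))\<^sup>2 < c"
proof -
  show s: "supp \<alpha> \<subseteq> supp \<beta>" using assms(1) by (auto simp: D2_def split: if_splits)
  define n where "n = norm (op_powr \<beta> (- 1/4) ** \<alpha> ** op_powr \<beta> (- 1/4))"
  have "2 * elog2 n < ereal (log 2 c)"
    using assms(1) s by (simp add: D2_def schatten_norm_2 n_def)
  moreover have "n \<ge> 0" by (simp add: n_def)
  ultimately have "n\<^sup>2 < c"
  \<comment> \<open>For \<open>n = 0\<close> the logarithm is minus infinity, and
    \<open>0 < c\<close> gives the claim.\<close>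
  proof (cases "n = 0")
    case False
    hence "n > 0" using \<open>n \<ge> 0\<close> by simp
    have "2 * log 2 n < log 2 c"
      using \<open>2 * elog2 n < _\<close> False by (simp add: elog2_def)
    hence "log 2 (n\<^sup>2) < log 2 c"
      using \<open>n > 0\<close> by (simp add: log_nat_power)
    thus ?thesis using \<open>n > 0\<close> \<open>0 < c\<close> by simp
  qed (use \<open>0 < c\<close> in simp)
  thus "(norm (op_powr \<beta> (- 1/4) ** \<alpha> ** op_powr \<beta> (- 1/4)))\<^sup>2 < c" by (simp add: n_def)
qed

text \<open>\<open>\<alpha>\<close> need not be block diagonal, but discarding its off-diagonal
  blocks only decreases the Hilbert-Schmidt norm. The classical factor scales block \<open>v\<close>
  by \<open>b v powr (-1/2)\<close>, hence \<open>1 / b v\<close> after squaring. The second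
  conclusion takes care of \<open>b v = 0\<close>, where the quotient in the third is 0 by
  convention.\<close>

lemma D2_blocks:
  fixes \<alpha> :: "('w::finite \<times> 'e::finite) op"
  assumes D2: "D2 \<alpha> (tensor (real_diag b) (V ** real_diag e ** dagger V)) < ereal (log 2 c)" "0 < c"
    and V: "unitary V" and b: "\<And>v. 0 \<le> b v" and e: "\<And>k. 0 \<le> e k" and \<alpha>: "hermitian \<alpha>"
  shows "supported V e (block \<alpha> v)"
    and "b v = 0 \<Longrightarrow> weighted V e (block \<alpha> v) = 0"
    and "(\<Sum>v\<in>UNIV. (norm (weighted V e (block \<alpha> v)))\<^sup>2 / b v) < c"
proof -
  define U :: "('w \<times> 'e) op" where "U = tensor (mat 1) V"
  define d :: "'w \<times> 'e \<Rightarrow> real" where "d p = b (fst p) * e (snd p)" for p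
  define \<alpha>' where "\<alpha>' = dagger U ** \<alpha> ** U"
  have U: "unitary U" unfolding U_def using V by (intro unitary_tensor unitary_mat_1)
  have \<beta>: "tensor (real_diag b) (V ** real_diag e ** dagger V) = U ** real_diag d ** dagger U"
    unfolding U_def d_def by (simp add: dagger_tensor tensor_mult tensor_real_diag[symmetric])
  have blk: "block \<alpha>' v = dagger V ** block \<alpha> v ** V" for v
    by (simp add: \<alpha>'_def U_def block_similar)
  have row: "\<alpha>' $ p $ q = 0" if "d p = 0" for p q
    unfolding \<alpha>'_def by (rule supp_subset_similar_row[OF D2_lessD(1)[OF D2, unfolded \<beta>] U that])
  have "hermitian \<alpha>'"
    using \<alpha> by (simp add: hermitian_def \<alpha>'_def dagger_mult matrix_mul_assoc)
  hence "\<alpha>' $ p $ q = cnj (\<alpha>' $ q $ p)" for p q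
    unfolding hermitian_def by (metis dagger_nth)
  \<comment> \<open>Hermiticity turns the vanishing rows into vanishing columns.\<close>
  hence zero: "\<alpha>' $ p $ q = 0" if "d p = 0 \<or> d q = 0" for p q
    using row that by (metis complex_cnj_zero)
  have nth: "(dagger V ** block \<alpha> v ** V) $ k $ l = \<alpha>' $ (v, k) $ (v, l)" for v k l
    by (simp add: blk[symmetric])
  show "supported V e (block \<alpha> v)"
    unfolding supported_def nth by (auto intro!: zero simp: d_def)
  show "weighted V e (block \<alpha> v) = 0" if "b v = 0"
    using that by (simp add: vec_eq_iff weighted_nth nth zero d_def)
  define D where "D = real_diag (\<lambda>p. d p powr (-1/4))"
  have "op_powr (U ** real_diag d ** dagger U) (- 1/4) ** \<alpha> ** op_powr (U ** real_diag d ** dagger U) (- 1/4)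
      = U ** (D ** \<alpha>' ** D) ** dagger U"
    unfolding op_powr_eq[OF U] D_def \<alpha>'_def by (simp add: matrix_mul_assoc)
  hence "(norm (D ** \<alpha>' ** D))\<^sup>2 < c"
    using D2_lessD(2)[OF D2, unfolded \<beta>] by (simp add: norm_unitary_left[OF U] norm_unitary_right[OF unitary_dagger[OF U]])
  moreover have "(\<Sum>v\<in>UNIV. (norm (weighted V e (block \<alpha> v)))\<^sup>2 / b v) \<le> (norm (D ** \<alpha>' ** D))\<^sup>2"
  proof -
    have sq: "(b v powr (-1/4) * b v powr (-1/4))\<^sup>2 = 1 / b v" for v
      using b[of v] by (cases "b v = 0") (simp_all add: powr_add[symmetric] power2_eq_square powr_minus_divide)
    have "(norm (weighted V e (block \<alpha> v)))\<^sup>2 / b v =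
        (\<Sum>k\<in>UNIV. \<Sum>l\<in>UNIV. (cmod ((D ** \<alpha>' ** D) $ (v, k) $ (v, l)))\<^sup>2)" for v
    proof -
      have "(D ** \<alpha>' ** D) $ (v, k) $ (v, l) =
          of_real (b v powr (-1/4) * b v powr (-1/4)) * weighted V e (block \<alpha> v) $ k $ l" for k l
        using b e by (simp add: D_def real_diag_left real_diag_right weighted_nth nth d_def powr_mult mult_ac)
      hence "(cmod ((D ** \<alpha>' ** D) $ (v, k) $ (v, l)))\<^sup>2 = (1 / b v) * (cmod (weighted V e (block \<alpha> v) $ k $ l))\<^sup>2" for k l
        unfolding sq[symmetric] by (simp add: norm_mult power_mult_distrib)
      thus ?thesis by (simp add: norm_op_square sum_divide_distrib)
    qed
    \<comment> \<open>This is the pinching: of all column blocks \<open>u\<close> only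
      \<open>u = v\<close> is kept.\<close>
    moreover have "(\<Sum>l\<in>UNIV. (cmod ((D ** \<alpha>' ** D) $ (v, k) $ (v, l)))\<^sup>2) \<le>
        (\<Sum>u\<in>UNIV. \<Sum>l\<in>UNIV. (cmod ((D ** \<alpha>' ** D) $ (v, k) $ (u, l)))\<^sup>2)" for v k
      by (rule member_le_sum[of v UNIV "\<lambda>u. \<Sum>l\<in>UNIV. (cmod ((D ** \<alpha>' ** D) $ (v, k) $ (u, l)))\<^sup>2"])
         (auto intro: sum_nonneg)
    ultimately show ?thesis
      unfolding norm_op_square sum_prod_UNIV by (simp add: sum_mono)
  qed
  ultimately show "(\<Sum>v\<in>UNIV. (norm (weighted V e (block \<alpha> v)))\<^sup>2 / b v) < c" by simp
qed

text \<open>\<open>g\<close> plays the conditional mean of \<open>s\<close> over the fibres of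
  \<open>w\<close>; the form without division leaves it free on fibres of probability zero. The
  ensemble \<open>A\<close> consists of the diagonal blocks of a smoothing operator, normalised by
  the fibre probabilities.\<close>

lemma smooth_I2_blocks:
  fixes \<pi> :: "'z::finite pmf" and s :: "'z \<Rightarrow> 'e::finite op" and w :: "'z \<Rightarrow> 'w::finite"
  assumes s: "\<And>z. psd (s z)" "\<And>z. Re (trace (s z)) \<le> 1"
    and \<tau>: "\<tau> = (\<Sum>z\<in>UNIV. pmf \<pi> z *\<^sub>R tensor (basis_proj (w z)) (s z))"
    and V: "unitary V" and mean: "(\<Sum>z\<in>UNIV. pmf \<pi> z *\<^sub>R s z) = V ** real_diag e ** dagger V"
    and I2: "smooth_I2 \<epsilon> \<tau> + ereal (log 2 (1 / \<epsilon>\<^sup>2)) < ereal (log 2 n)" and "0 < n" "0 < \<epsilon>"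
    and g: "\<And>z. (\<Sum>y | w y = w z. pmf \<pi> y) *\<^sub>R g z = (\<Sum>y | w y = w z. pmf \<pi> y *\<^sub>R s y)"
  shows "\<exists>A. (\<forall>z. supported V e (A z)) \<and>
    (\<Sum>z\<in>UNIV. pmf \<pi> z * trace_norm (g z - A z)) \<le> \<epsilon> \<and>
    (\<Sum>z\<in>UNIV. pmf \<pi> z * (norm (weighted V e (A z)))\<^sup>2) \<le> \<epsilon>\<^sup>2 * n"
proof -
  define T where "T v = (\<Sum>z | w z = v. pmf \<pi> z *\<^sub>R s z)" for v
  define b where "b v = Re (trace (T v))" for v
  define P where "P v = (\<Sum>z | w z = v. pmf \<pi> z)" for v
  have \<tau>_nth: "\<tau> $ (u, k) $ (v, l) = (if u = v then T v $ k $ l else 0)" for u v k l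
    unfolding \<tau> block_cq T_def ..
  have T: "psd (T v)" for v unfolding T_def by (intro psd_sum psd_scaleR s) simp
  have b0: "0 \<le> b v" for v unfolding b_def using psd_trace(2)[OF T] .
  \<comment> \<open>The operators \<open>s z\<close> may have trace below one, so the classical
    marginal \<open>b\<close> of the state can be smaller than the distribution \<open>P\<close> of
    the label. The inequality points in the direction that the second moment needs below.\<close>
  have bP: "b v \<le> P v" for v
  proof -
    have "b v = (\<Sum>z | w z = v. pmf \<pi> z * Re (trace (s z)))"
      by (simp add: b_def T_def trace_sum trace_scaleR)
    also have "\<dots> \<le> (\<Sum>z | w z = v. pmf \<pi> z * 1)"
      by (intro sum_mono mult_left_mono s) simp
    finally show ?thesis by (simp add: P_def)
  qed
  have sumP: "(\<Sum>v\<in>UNIV. P v) = 1"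
    unfolding P_def sum_fibres by (rule sum_pmf_eq_1) auto
  have mean_e: "psd (V ** real_diag e ** dagger V)"
    unfolding mean[symmetric] by (intro psd_sum psd_scaleR s) simp
  have e0: "0 \<le> e k" for k using psd_eigenvalues[OF mean_e V] .
  have W: "ptrace (\<lambda>(w, e). (w, e)) \<tau> = real_diag b"
  proof -
    have "(\<Sum>r\<in>UNIV. \<tau> $ (u, r) $ (v, r)) = real_diag b $ u $ v" for u v
      using psd_trace(1)[OF T, of v] by (simp add: \<tau>_nth real_diag_def b_def) (simp add: trace_def)
    thus ?thesis by (simp add: vec_eq_iff ptrace_def)
  qed
  have E: "ptrace (\<lambda>(e, w). (w, e)) \<tau> = V ** real_diag e ** dagger V"
    unfolding \<tau> ptrace_cq_quantum mean ..
  \<comment> \<open>Moving \<open>log 2 (1 / \<epsilon>\<^sup>2)\<close> to the other side turns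
    \<open>n\<close> into \<open>\<epsilon>\<^sup>2 * n\<close>; the case split deals with infinite
    entropies.\<close>
  have "smooth_I2 \<epsilon> \<tau> < ereal (log 2 (\<epsilon>\<^sup>2 * n))"
  proof -
    have "log 2 (\<epsilon>\<^sup>2 * n) = log 2 n - log 2 (1 / \<epsilon>\<^sup>2)"
      using \<open>0 < n\<close> \<open>0 < \<epsilon>\<close> by (simp add: log_mult log_divide)
    thus ?thesis
      using I2 by (cases "smooth_I2 \<epsilon> \<tau>") auto
  qed
  then obtain \<alpha> where \<alpha>: "subnormalised \<alpha>" "schatten_norm 1 (\<alpha> - \<tau>) \<le> \<epsilon> * Re (trace \<tau>)"
    and D2: "D2 \<alpha> (tensor (real_diag b) (V ** real_diag e ** dagger V)) < ereal (log 2 (\<epsilon>\<^sup>2 * n))"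
    unfolding smooth_I2_def W E smooth_D2_def INF_less_iff by auto
  have "0 < \<epsilon>\<^sup>2 * n" using \<open>0 < n\<close> \<open>0 < \<epsilon>\<close> by simp
  have herm: "hermitian \<alpha>" using \<alpha>(1) psd_hermitian by (auto simp: subnormalised_def)
  note D = D2_blocks[OF D2 \<open>0 < \<epsilon>\<^sup>2 * n\<close> V b0 e0 herm]
  have "hermitian \<tau>"
  proof -
    have "cnj (T v $ k $ l) = T v $ l $ k" for v k l
      using psd_hermitian[OF T, of v] unfolding hermitian_def by (metis dagger_nth)
    thus ?thesis by (simp add: hermitian_def vec_eq_iff \<tau>_nth)
  qed
  hence h: "hermitian (\<alpha> - \<tau>)" using herm hermitian_diff by blast
  have tr: "Re (trace \<tau>) \<le> 1"
  proof -
    have "Re (trace \<tau>) = (\<Sum>v\<in>UNIV. b v)"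
      by (simp add: trace_def sum_prod_UNIV \<tau>_nth b_def)
    also have "\<dots> \<le> 1" using sumP bP by (metis sum_mono)
    finally show ?thesis .
  qed
  have block_\<tau>: "block \<tau> v = T v" for v by (simp add: vec_eq_iff \<tau>_nth)
  have dist: "(\<Sum>v\<in>UNIV. trace_norm (block \<alpha> v - T v)) \<le> \<epsilon>"
  proof -
    have "(\<Sum>v\<in>UNIV. trace_norm (block \<alpha> v - T v)) \<le> trace_norm (\<alpha> - \<tau>)"
      using trace_norm_pinching[OF h] by (simp add: block_diff block_\<tau>)
    also have "\<dots> \<le> \<epsilon> * Re (trace \<tau>)"
      using \<alpha>(2) hermitian_norm_1(1)[OF h] by simp
    also have "\<dots> \<le> \<epsilon>" using tr \<open>0 < \<epsilon>\<close> by simp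
    finally show ?thesis .
  qed
  \<comment> \<open>If \<open>P (w z) = 0\<close>, division by zero yields the zero operator; such
    letters have weight 0 in every mean.\<close>
  define A where "A z = (1 / P (w z)) *\<^sub>R block \<alpha> (w z)" for z
  have "supported V e (A z)" for z
    unfolding A_def by (intro supported_scaleR D(1))
  moreover have "(\<Sum>z\<in>UNIV. pmf \<pi> z * trace_norm (g z - A z)) \<le> \<epsilon>"
  proof -
    have eq: "pmf \<pi> z * trace_norm (g z - A z) = pmf \<pi> z * (trace_norm (block \<alpha> (w z) - T (w z)) / P (w z))" for z
    proof (cases "pmf \<pi> z = 0")
      case False
      have "pmf \<pi> z \<le> P (w z)"
        unfolding P_def by (rule member_le_sum) auto
      hence P: "P (w z) > 0" using False pmf_nonneg[of \<pi> z] by linarith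
      have "P (w z) *\<^sub>R g z = T (w z)" using g[of z] by (simp add: P_def T_def)
      hence "g z = (1 / P (w z)) *\<^sub>R T (w z)" using P by (metis divideR_right less_irrefl scaleR_one inverse_eq_divide)
      hence "g z - A z = (1 / P (w z)) *\<^sub>R (T (w z) - block \<alpha> (w z))"
        by (simp add: A_def scaleR_diff_right)
      thus ?thesis
        using P by (simp add: trace_norm_scaleR trace_norm_minus_commute)
    qed simp
    have "(\<Sum>z\<in>UNIV. pmf \<pi> z * trace_norm (g z - A z)) =
        (\<Sum>v\<in>UNIV. \<Sum>z | w z = v. pmf \<pi> z * (trace_norm (block \<alpha> v - T v) / P v))"
      unfolding eq by (subst sum_fibres[of _ w, symmetric]) simp
    also have "\<dots> = (\<Sum>v\<in>UNIV. P v * (trace_norm (block \<alpha> v - T v) / P v))"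
      by (simp only: P_def sum_distrib_right)
    also have "\<dots> \<le> (\<Sum>v\<in>UNIV. trace_norm (block \<alpha> v - T v))"
      by (intro sum_mono) (auto simp: trace_norm_nonneg)
    finally show ?thesis using dist by simp
  qed
  moreover have "(\<Sum>z\<in>UNIV. pmf \<pi> z * (norm (weighted V e (A z)))\<^sup>2) \<le> \<epsilon>\<^sup>2 * n"
  proof -
    have "(\<Sum>z\<in>UNIV. pmf \<pi> z * (norm (weighted V e (A z)))\<^sup>2) =
        (\<Sum>v\<in>UNIV. \<Sum>z | w z = v. pmf \<pi> z * ((norm (weighted V e (block \<alpha> v)))\<^sup>2 / (P v)\<^sup>2))"
      by (subst sum_fibres[of _ w, symmetric])
         (simp add: A_def linear_scale[OF weighted_linear] power_mult_distrib power_divide)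
    also have "\<dots> = (\<Sum>v\<in>UNIV. P v * ((norm (weighted V e (block \<alpha> v)))\<^sup>2 / (P v)\<^sup>2))"
      by (simp only: P_def sum_distrib_right)
    \<comment> \<open>Normalising costs \<open>1 / P v\<close> twice and averaging returns one
      \<open>P v\<close>; the remaining \<open>1 / P v\<close> is at most \<open>1 / b v\<close>.
      For \<open>b v = 0\<close> the weighted block itself vanishes.\<close>
    also have "\<dots> \<le> (\<Sum>v\<in>UNIV. (norm (weighted V e (block \<alpha> v)))\<^sup>2 / b v)"
    proof (rule sum_mono)
      fix v
      show "P v * ((norm (weighted V e (block \<alpha> v)))\<^sup>2 / (P v)\<^sup>2) \<le> (norm (weighted V e (block \<alpha> v)))\<^sup>2 / b v"
      proof (cases "b v = 0")
        case False
        hence "0 < b v" using b0[of v] by simp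
        hence "0 < P v" using bP[of v] by linarith
        hence "P v * ((norm (weighted V e (block \<alpha> v)))\<^sup>2 / (P v)\<^sup>2) = (norm (weighted V e (block \<alpha> v)))\<^sup>2 / P v"
          by (simp add: power2_eq_square)
        thus ?thesis using \<open>0 < b v\<close> bP[of v] by (simp add: frac_le)
      qed (simp add: D(2))
    qed
    also have "\<dots> < \<epsilon>\<^sup>2 * n" by (rule D(3))
    finally show ?thesis by simp
  qed
  ultimately show ?thesis by blast
qed

subsection \<open>Second moments of codebook averages\<close>

text \<open>A finite sum in place of an integral: operator-valued functions need no integrability
  conditions, and exchanging means is exchanging sums.\<close>

definition mean :: "'z::finite pmf \<Rightarrow> ('z \<Rightarrow> 'v::real_vector) \<Rightarrow> 'v" where
  "mean p f = (\<Sum>z\<in>UNIV. pmf p z *\<^sub>R f z)"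

lemma mean_add: "mean p (\<lambda>z. f z + g z) = mean p f + mean p g"
  by (simp add: mean_def scaleR_add_right sum.distrib)

lemma mean_diff: "mean p (\<lambda>z. f z - g z) = mean p f - mean p g"
  by (simp add: mean_def scaleR_diff_right sum_subtractf)

lemma mean_scaleR: "mean p (\<lambda>z. c *\<^sub>R f z) = c *\<^sub>R mean p f"
  by (simp add: mean_def scaleR_sum_right mult.commute)

lemma mean_cmult: "mean p (\<lambda>z. c * f z) = c * mean p f" for c :: real
  using mean_scaleR[of p c f] by simp

lemma mean_const: "mean p (\<lambda>_. c) = c"
  by (simp add: mean_def scaleR_sum_left[symmetric] sum_pmf_eq_1)

lemma mean_sum: "mean p (\<lambda>z. \<Sum>i\<in>I. f i z) = (\<Sum>i\<in>I. mean p (f i))"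
  by (simp add: mean_def scaleR_sum_right sum.swap[of _ I])

lemma mean_swap: "mean p (\<lambda>x. mean q (f x)) = mean q (\<lambda>y. mean p (\<lambda>x. f x y))"
  by (simp add: mean_def scaleR_sum_right sum.swap[of _ "UNIV :: 'b set"] mult.commute)

lemma mean_mono: "(\<And>z. f z \<le> g z) \<Longrightarrow> mean p f \<le> (mean p g :: real)"
  by (simp add: mean_def sum_mono mult_left_mono)

lemma mean_nonneg: "(\<And>z. 0 \<le> f z) \<Longrightarrow> 0 \<le> (mean p f :: real)"
  by (simp add: mean_def sum_nonneg)

lemma mean_inner: "mean p (\<lambda>z. inner c (f z)) = inner c (mean p f)"
  by (simp add: mean_def inner_sum_right)

lemma mean_deviation_scaleR:
  fixes f :: "'z::finite \<Rightarrow> 'v::real_inner"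
  shows "mean p (\<lambda>z. (norm (c *\<^sub>R f z - mean p (\<lambda>z. c *\<^sub>R f z)))\<^sup>2) = c\<^sup>2 * mean p (\<lambda>z. (norm (f z - mean p f))\<^sup>2)"
  by (simp add: mean_scaleR scaleR_diff_right[symmetric] power_mult_distrib mean_cmult)

lemma expectation_mean: "measure_pmf.expectation p f = mean p (f :: 'z::finite \<Rightarrow> real)"
  by (simp add: mean_def integral_measure_pmf_real[of UNIV] mult.commute)

text \<open>Squared bias plus variance. The shift \<open>c\<close> makes room for the other summands
  in the induction over independent letters.\<close>

lemma mean_norm_square_shift:
  fixes f :: "'z::finite \<Rightarrow> 'v::real_inner"
  shows "mean p (\<lambda>z. (norm (c + f z))\<^sup>2) = (norm (c + mean p f))\<^sup>2 + mean p (\<lambda>z. (norm (f z - mean p f))\<^sup>2)"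
proof -
  define m where "m = mean p f"
  have "(norm (c + f z))\<^sup>2 = (norm (c + m))\<^sup>2 + 2 * inner (c + m) (f z - m) + (norm (f z - m))\<^sup>2" for z
    by (simp add: power2_norm_eq_inner inner_add_left inner_add_right inner_diff_left inner_diff_right
        inner_commute algebra_simps)
  hence "mean p (\<lambda>z. (norm (c + f z))\<^sup>2) =
      (norm (c + m))\<^sup>2 + 2 * inner (c + m) (mean p (\<lambda>z. f z - m)) + mean p (\<lambda>z. (norm (f z - m))\<^sup>2)"
    by (simp add: mean_add mean_const mean_cmult mean_inner)
  thus ?thesis by (simp add: mean_diff mean_const m_def)
qed

section \<open>Expectations under products of finitely supported laws\<close>

lemma finite_set_Pi_pmf:
  "finite I \<Longrightarrow> finite (set_pmf (Pi_pmf I d (p :: 'i \<Rightarrow> 'a::finite pmf)))"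
  by (simp add: set_Pi_pmf finite_PiE_dflt)

lemma expectation_finite_sum:
  fixes f :: "'i \<Rightarrow> 'a \<Rightarrow> real"
  assumes "finite (set_pmf p)"
  shows "measure_pmf.expectation p (\<lambda>x. \<Sum>i\<in>I. f i x) = (\<Sum>i\<in>I. measure_pmf.expectation p (f i))"
  by (intro Bochner_Integration.integral_sum integrable_measure_pmf_finite assms)

lemma expectation_finite_add:
  fixes f :: "'a \<Rightarrow> real"
  assumes "finite (set_pmf p)"
  shows "measure_pmf.expectation p (\<lambda>x. f x + g x) = measure_pmf.expectation p f + measure_pmf.expectation p g"
  by (intro Bochner_Integration.integral_add integrable_measure_pmf_finite assms)

lemma expectation_finite_mono:
  fixes f :: "'a \<Rightarrow> real"
  assumes "finite (set_pmf p)" "\<And>x. f x \<le> g x"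
  shows "measure_pmf.expectation p f \<le> measure_pmf.expectation p g"
  by (intro integral_mono integrable_measure_pmf_finite assms)

lemma expectation_finite_mean:
  assumes "finite (set_pmf p)"
  shows "measure_pmf.expectation p (\<lambda>x. mean q (f x)) = mean q (\<lambda>z. measure_pmf.expectation p (\<lambda>x. f x z :: real))"
  using assms by (simp add: mean_def expectation_finite_sum)

lemma expectation_Pi_component:
  fixes p :: "'i \<Rightarrow> 'a::finite pmf" and h :: "'a \<Rightarrow> real"
  assumes "finite I" "i \<in> I"
  shows "measure_pmf.expectation (Pi_pmf I d p) (\<lambda>x. h (x i)) = mean (p i) h"
proof -
  have "measure_pmf.expectation (map_pmf (\<lambda>x. x i) (Pi_pmf I d p)) h = mean (p i) h"
    using assms by (simp add: Pi_pmf_component expectation_mean)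
  thus ?thesis by simp
qed

text \<open>Independent deviations are uncorrelated, so variances add. Generalising over
  \<open>c\<close> absorbs the letter at the inserted index. Laws and functions may vary with the
  index because, given the primed letters, the cells of a codebook are differently
  distributed.\<close>

lemma expectation_Pi_norm_square:
  fixes p :: "'i \<Rightarrow> 'a::finite pmf" and h :: "'i \<Rightarrow> 'a \<Rightarrow> 'v::real_inner"
  assumes "finite I"
  shows "measure_pmf.expectation (Pi_pmf I d p) (\<lambda>x. (norm (c + (\<Sum>i\<in>I. h i (x i))))\<^sup>2) =
    (norm (c + (\<Sum>i\<in>I. mean (p i) (h i))))\<^sup>2 + (\<Sum>i\<in>I. mean (p i) (\<lambda>z. (norm (h i z - mean (p i) (h i)))\<^sup>2))"
  using assms
proof (induction I arbitrary: c rule: finite_induct)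
  case (insert j I)
  let ?m = "\<lambda>i. mean (p i) (h i)"
  let ?v = "\<Sum>i\<in>I. mean (p i) (\<lambda>z. (norm (h i z - ?m i))\<^sup>2)"
  have ne: "i \<noteq> j" if "i \<in> I" for i using insert.hyps that by auto
  have "measure_pmf.expectation (Pi_pmf (insert j I) d p) (\<lambda>x. (norm (c + (\<Sum>i\<in>insert j I. h i (x i))))\<^sup>2) =
      mean (p j) (\<lambda>y. measure_pmf.expectation (map_pmf (\<lambda>f. f(j := y)) (Pi_pmf I d p))
        (\<lambda>x. (norm (c + (\<Sum>i\<in>insert j I. h i (x i))))\<^sup>2))"
    unfolding Pi_pmf_insert'[OF insert.hyps] mean_def map_pmf_def[symmetric]
    by (rule pmf_expectation_bind) (use insert.hyps in \<open>auto intro: finite_set_Pi_pmf\<close>)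
  also have "\<dots> = mean (p j) (\<lambda>y. measure_pmf.expectation (Pi_pmf I d p)
        (\<lambda>x. (norm ((c + h j y) + (\<Sum>i\<in>I. h i (x i))))\<^sup>2))"
    using insert.hyps ne by (simp add: add.assoc cong: sum.cong)
  also have "\<dots> = mean (p j) (\<lambda>y. (norm ((c + (\<Sum>i\<in>I. ?m i)) + h j y))\<^sup>2 + ?v)"
    unfolding insert.IH by (simp add: add_ac)
  also have "\<dots> = (norm ((c + (\<Sum>i\<in>I. ?m i)) + ?m j))\<^sup>2 + mean (p j) (\<lambda>y. (norm (h j y - ?m j))\<^sup>2) + ?v"
    by (simp add: mean_add mean_const mean_norm_square_shift)
  finally show ?case using insert.hyps by (simp add: add_ac)
qed simp

section \<open>Codebooks: primed letters, then letters conditioned on them\<close>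

lemma pmf_conditional:
  fixes p :: "('a::finite \<times> 'b::finite) pmf"
  shows "pmf p (x, y) = pmf (map_pmf fst p) x * pmf (conditional p x) y"
proof (cases "pmf (map_pmf fst p) x = 0")
  \<comment> \<open>The conditional law is unspecified on a null event, but here both sides are
    0.\<close>
  case True
  hence "x \<notin> fst ` set_pmf p" by (simp add: pmf_eq_0_set_pmf)
  hence "(x, y) \<notin> set_pmf p" by force
  thus ?thesis using True by (metis mult_zero_left pmf_eq_0_set_pmf)
next
  case False
  let ?S = "{z. fst z = x}"
  have S: "set_pmf p \<inter> ?S \<noteq> {}"
    using False by (auto simp: pmf_eq_0_set_pmf)
  have m: "measure p ?S = pmf (map_pmf fst p) x"
    by (simp add: pmf_map vimage_def)
  have "pmf (conditional p x) y = measure (cond_pmf p ?S) {z. snd z = y}"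
    by (simp add: conditional_def pmf_map vimage_def)
  also have "\<dots> = measure (cond_pmf p ?S) {(x, y)}"
    by (rule measure_pmf.finite_measure_eq_AE) (auto simp: AE_measure_pmf_iff S)
  also have "\<dots> = pmf p (x, y) / pmf (map_pmf fst p) x"
    by (simp add: measure_pmf_single pmf_cond[OF S] m)
  finally show ?thesis using False by simp
qed

lemma mean_conditional:
  fixes p :: "('a::finite \<times> 'b::finite) pmf"
  shows "mean p f = mean (map_pmf fst p) (\<lambda>x. mean (conditional p x) (\<lambda>y. f (x, y)))"
  by (simp add: mean_def sum_prod_UNIV pmf_conditional scaleR_sum_right)

lemma finite_set_codebook:
  "finite (set_pmf (codebook (p :: ('a::finite \<times> 'b::finite) pmf) L' L))"
  unfolding codebook_def by (auto intro!: finite_set_Pi_pmf)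

lemma expectation_codebook:
  fixes p :: "('a::finite \<times> 'b::finite) pmf" and f :: "_ \<Rightarrow> real"
  shows "measure_pmf.expectation (codebook p L' L) f =
    measure_pmf.expectation (Pi_pmf {1..L'} undefined (\<lambda>_. map_pmf fst p)) (\<lambda>xs'.
      measure_pmf.expectation (Pi_pmf ({1..L'} \<times> {1..L}) undefined (\<lambda>(a', a). conditional p (xs' a')))
        (\<lambda>xs. f (xs', xs)))"
proof -
  let ?P = "Pi_pmf {1..L'} undefined (\<lambda>_. map_pmf fst p)"
  have fin: "finite (set_pmf ?P)" by (intro finite_set_Pi_pmf) simp
  show ?thesis
    unfolding codebook_def
    by (subst pmf_expectation_bind[OF fin _ order.refl])
       (auto intro!: finite_set_Pi_pmf simp: integral_measure_pmf[OF fin])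
qed

definition sample :: "nat \<Rightarrow> nat \<Rightarrow> ('a \<times> 'b \<Rightarrow> 'v::real_vector) \<Rightarrow> (nat \<Rightarrow> 'a) \<times> (nat \<times> nat \<Rightarrow> 'b) \<Rightarrow> 'v" where
  "sample L' L f c = (1 / real (L' * L)) *\<^sub>R (\<Sum>a'=1..L'. \<Sum>a=1..L. f (fst c a', snd c (a', a)))"

text \<open>Every cell \<open>(a', a)\<close> of a codebook has law \<open>p\<close>. Cells with the
  same \<open>a'\<close> are dependent, but linearity is enough.\<close>

lemma expectation_sample:
  fixes p :: "('a::finite \<times> 'b::finite) pmf" and h :: "_ \<Rightarrow> real"
  assumes "0 < L'" "0 < L"
  shows "measure_pmf.expectation (codebook p L' L) (sample L' L h) = mean p h"
proof -
  let ?P = "Pi_pmf {1..L'} undefined (\<lambda>_. map_pmf fst p)"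
  have fin: "finite (set_pmf ?P)" by (intro finite_set_Pi_pmf) simp
  have one: "measure_pmf.expectation (codebook p L' L) (\<lambda>c. h (fst c a', snd c (a', a))) = mean p h"
    if "a' \<in> {1..L'}" "a \<in> {1..L}" for a' a
  proof -
    have "measure_pmf.expectation (codebook p L' L) (\<lambda>c. h (fst c a', snd c (a', a))) =
        measure_pmf.expectation ?P (\<lambda>xs'. mean (conditional p (xs' a')) (\<lambda>y. h (xs' a', y)))"
    proof -
      have "measure_pmf.expectation (Pi_pmf ({1..L'} \<times> {1..L}) undefined (\<lambda>(a', a). conditional p (xs' a')))
          (\<lambda>xs. h (xs' a', xs (a', a))) = mean (conditional p (xs' a')) (\<lambda>y. h (xs' a', y))" for xs'
        by (subst expectation_Pi_component[where h = "\<lambda>y. h (xs' a', y)"]) (use that in auto)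
      thus ?thesis unfolding expectation_codebook by simp
    qed
    also have "\<dots> = mean (map_pmf fst p) (\<lambda>x. mean (conditional p x) (\<lambda>y. h (x, y)))"
      using that
      by (subst expectation_Pi_component[where h = "\<lambda>x. mean (conditional p x) (\<lambda>y. h (x, y))"]) auto
    finally show ?thesis by (simp add: mean_conditional)
  qed
  have "measure_pmf.expectation (codebook p L' L) (sample L' L h) =
      (1 / real (L' * L)) * (\<Sum>a'=1..L'. \<Sum>a=1..L. mean p h)"
    unfolding sample_def real_scaleR_def integral_mult_right_zero expectation_finite_sum[OF finite_set_codebook]
    by (simp add: one)
  thus ?thesis using assms by simp
qed

text \<open>The result stays a function of the full pair at every level, so that levels can be
  composed and subtracted.\<close>

definition level_mean :: "('a::finite \<times> 'b::finite) pmf \<Rightarrow> nat \<Rightarrow> ('a \<times> 'b \<Rightarrow> 'v::real_vector) \<Rightarrow> 'a \<times> 'b \<Rightarrow> 'v" where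
  "level_mean p i f z = (if i = 0 then mean p f
     else if i = 1 then mean (conditional p (fst z)) (\<lambda>y. f (fst z, y)) else f z)"

text \<open>Martingale differences along the levels. Level 0 is singled out because
  \<open>0 - 1 = 0\<close> on naturals would cancel the mean.\<close>

definition level_diff :: "('a::finite \<times> 'b::finite) pmf \<Rightarrow> nat \<Rightarrow> ('a \<times> 'b \<Rightarrow> 'v::real_vector) \<Rightarrow> 'a \<times> 'b \<Rightarrow> 'v" where
  "level_diff p i f z = level_mean p i f z - (if i = 0 then 0 else level_mean p (i - 1) f z)"

text \<open>The number of independent draws at a level, by which the variance arising there is
  divided.\<close>

definition level_size :: "nat \<Rightarrow> nat \<Rightarrow> nat \<Rightarrow> real" where
  "level_size L' L i = (if i = 0 then 1 else if i = 1 then real L' else real L' * real L)"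

text \<open>The law of total variance in two layers. Given the primed letters, the cells are
  independent and contribute the conditional variance divided by \<open>L' * L\<close>; the
  conditional means form an average over \<open>L'\<close> independent letters.\<close>

lemma expectation_sample_norm_square:
  fixes p :: "('a::finite \<times> 'b::finite) pmf" and f :: "_ \<Rightarrow> 'v::real_inner"
  assumes "0 < L'" "0 < L"
  shows "measure_pmf.expectation (codebook p L' L) (\<lambda>c. (norm (sample L' L f c))\<^sup>2) =
    (\<Sum>i\<le>2. mean p (\<lambda>z. (norm (level_diff p i f z))\<^sup>2) / level_size L' L i)"
proof -
  let ?P = "Pi_pmf {1..L'} undefined (\<lambda>_. map_pmf fst p)"
  define m where "m x = mean (conditional p x) (\<lambda>y. f (x, y))" for x
  define v where "v x = mean (conditional p x) (\<lambda>y. (norm (f (x, y) - m x))\<^sup>2)" for x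
  have fin: "finite (set_pmf ?P)" by (intro finite_set_Pi_pmf) simp
  \<comment> \<open>The leading \<open>0\<close> matches the shift in
    \<open>expectation_Pi_norm_square\<close>. Of the factor \<open>(L' * L)\<^sup>2\<close> one
    \<open>L\<close> is used up by the \<open>L\<close> equally distributed cells of each primed
    letter.\<close>
  have inner: "measure_pmf.expectation (Pi_pmf ({1..L'} \<times> {1..L}) undefined (\<lambda>(a', a). conditional p (xs' a')))
        (\<lambda>xs. (norm (sample L' L f (xs', xs)))\<^sup>2) =
      (norm (0 + (\<Sum>a'=1..L'. (1 / L') *\<^sub>R m (xs' a'))))\<^sup>2 + (\<Sum>a'=1..L'. v (xs' a') / (real L' * real L' * real L))" for xs'
  proof -
    define h where "h = (\<lambda>(a', a :: nat) y. (1 / real (L' * L)) *\<^sub>R f (xs' a', y))"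
    define q where "q = (\<lambda>(a' :: nat, a :: nat). conditional p (xs' a'))"
    have "sample L' L f (xs', xs) = 0 + (\<Sum>i\<in>{1..L'} \<times> {1..L}. h i (xs i))" for xs
      by (simp add: sample_def h_def sum.cartesian_product' scaleR_sum_right)
    hence "measure_pmf.expectation (Pi_pmf ({1..L'} \<times> {1..L}) undefined q)
        (\<lambda>xs. (norm (sample L' L f (xs', xs)))\<^sup>2) =
        (norm (0 + (\<Sum>i\<in>{1..L'} \<times> {1..L}. mean (q i) (h i))))\<^sup>2 +
        (\<Sum>i\<in>{1..L'} \<times> {1..L}. mean (q i) (\<lambda>z. (norm (h i z - mean (q i) (h i)))\<^sup>2))"
      by (simp only:) (intro expectation_Pi_norm_square, simp)
    also have "(\<Sum>i\<in>{1..L'} \<times> {1..L}. mean (q i) (h i)) = (\<Sum>a'=1..L'. (1 / L') *\<^sub>R m (xs' a'))"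
    proof -
      have "mean (q (a', a)) (h (a', a)) = (1 / real (L' * L)) *\<^sub>R m (xs' a')" for a' a
        by (simp add: q_def h_def mean_scaleR m_def)
      thus ?thesis
        using assms by (simp add: sum.cartesian_product' scaleR_sum_left[symmetric] sum_constant_scaleR)
    qed
    also have "(\<Sum>i\<in>{1..L'} \<times> {1..L}. mean (q i) (\<lambda>z. (norm (h i z - mean (q i) (h i)))\<^sup>2)) =
        (\<Sum>a'=1..L'. v (xs' a') / (real L' * real L' * real L))"
    proof -
      have *: "mean (q (a', a)) (\<lambda>z. (norm (h (a', a) z - mean (q (a', a)) (h (a', a))))\<^sup>2) =
          (1 / real (L' * L))\<^sup>2 * v (xs' a')" for a' a
        unfolding q_def h_def prod.case mean_deviation_scaleR v_def m_def ..
      show ?thesis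
        unfolding sum.cartesian_product' *
        using assms by (simp add: power2_eq_square field_simps)
    qed
    finally show ?thesis by (simp add: q_def)
  qed
  have mean_m: "mean (map_pmf fst p) m = mean p f"
    by (simp add: m_def[abs_def] mean_conditional[of p f])
  have "measure_pmf.expectation (codebook p L' L) (\<lambda>c. (norm (sample L' L f c))\<^sup>2) =
      measure_pmf.expectation ?P (\<lambda>xs'. (norm (0 + (\<Sum>a'=1..L'. (1 / L') *\<^sub>R m (xs' a'))))\<^sup>2) +
      (\<Sum>a'=1..L'. measure_pmf.expectation ?P (\<lambda>xs'. v (xs' a') / (real L' * real L' * real L)))"
    unfolding expectation_codebook inner by (simp only: expectation_finite_add[OF fin] expectation_finite_sum[OF fin])
  also have "measure_pmf.expectation ?P (\<lambda>xs'. (norm (0 + (\<Sum>a'=1..L'. (1 / L') *\<^sub>R m (xs' a'))))\<^sup>2) =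
      (norm (mean p f))\<^sup>2 + mean (map_pmf fst p) (\<lambda>x. (norm (m x - mean p f))\<^sup>2) / L'"
    using assms
    by (subst expectation_Pi_norm_square)
       (simp_all only: mean_deviation_scaleR mean_m finite_atLeastAtMost,
         simp add: mean_scaleR mean_m sum_constant_scaleR power2_eq_square)
  also have "(\<Sum>a'=1..L'. measure_pmf.expectation ?P (\<lambda>xs'. v (xs' a') / (real L' * real L' * real L))) =
      mean (map_pmf fst p) v / (real L' * real L)"
    using assms by (simp add: expectation_Pi_component[where h = v])
  \<comment> \<open>The two variances are mean squares of level differences: the conditional mean
    against the mean at level 1, and \<open>f\<close> against the conditional mean at level
    2.\<close>
  also have "mean (map_pmf fst p) (\<lambda>x. (norm (m x - mean p f))\<^sup>2) = mean p (\<lambda>z. (norm (level_diff p 1 f z))\<^sup>2)"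
    unfolding mean_conditional[of p "\<lambda>z. (norm (level_diff p 1 f z))\<^sup>2"]
    by (simp add: level_diff_def level_mean_def
        m_def mean_const)
  also have "mean (map_pmf fst p) v = mean p (\<lambda>z. (norm (level_diff p 2 f z))\<^sup>2)"
    unfolding mean_conditional[of p "\<lambda>z. (norm (level_diff p 2 f z))\<^sup>2"]
    by (simp add: level_diff_def level_mean_def
        m_def v_def[abs_def])
  also have "(norm (mean p f))\<^sup>2 = mean p (\<lambda>z. (norm (level_diff p 0 f z))\<^sup>2)"
    by (simp add: level_diff_def level_mean_def mean_const)
  finally show ?thesis
    by (simp add: numeral_2_eq_2 level_size_def)
qed

subsection \<open>Conditional expectations onto the levels of a codebook\<close>

text \<open>The equivalence relation over whose classes \<open>level_mean\<close> averages.\<close>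

definition same_level :: "nat \<Rightarrow> 'a \<times> 'b \<Rightarrow> 'a \<times> 'b \<Rightarrow> bool" where
  "same_level i u z \<longleftrightarrow> (if i = 0 then True else if i = 1 then fst u = fst z else u = z)"

text \<open>Without division the identity also holds on classes of probability zero, and this is the
  form that \<open>smooth_I2_blocks\<close> asks for.\<close>

lemma level_mean_fibre:
  fixes p :: "('a::finite \<times> 'b::finite) pmf"
  shows "(\<Sum>u | same_level i u z. pmf p u) *\<^sub>R level_mean p i f z = (\<Sum>u | same_level i u z. pmf p u *\<^sub>R f u)"
proof -
  consider "i = 0" | "i = 1" | "i \<noteq> 0" "i \<noteq> 1" by blast
  thus ?thesis
  proof cases
    case 1
    thus ?thesis by (simp add: same_level_def level_mean_def mean_def sum_pmf_eq_1)
  next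
    case 2
    have fib: "{u. same_level i u z} = Pair (fst z) ` (UNIV :: 'b set)"
      using 2 by (auto simp: same_level_def)
    show ?thesis
      unfolding fib using 2
      by (simp add: sum.reindex inj_on_def pmf_conditional sum_distrib_left[symmetric] sum_pmf_eq_1
          level_mean_def mean_def scaleR_sum_right)
  next
    case 3
    thus ?thesis by (simp add: same_level_def level_mean_def)
  qed
qed

text \<open>The transition matrix of \<open>level_mean\<close>. With kernels, linearity and the
  commutation of operators acting on different letters become rules for finite sums.\<close>

definition level_kernel :: "('a::finite \<times> 'b::finite) pmf \<Rightarrow> nat \<Rightarrow> 'a \<times> 'b \<Rightarrow> 'a \<times> 'b \<Rightarrow> real" where
  "level_kernel p i z u = (if i = 0 then pmf p u
     else if i = 1 then if fst u = fst z then pmf (conditional p (fst z)) (snd u) else 0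
     else if u = z then 1 else 0)"

lemma level_kernel_nonneg: "0 \<le> level_kernel p i z u"
  by (simp add: level_kernel_def)

lemma level_mean_kernel: "level_mean p i f z = (\<Sum>u\<in>UNIV. level_kernel p i z u *\<^sub>R f u)"
proof -
  consider "i = 0" | "i = 1" | "i \<noteq> 0" "i \<noteq> 1" by blast
  thus ?thesis
  proof cases
    case 2
    have "(\<Sum>u\<in>UNIV. level_kernel p i z u *\<^sub>R f u) =
        (\<Sum>a\<in>UNIV. if a = fst z then \<Sum>b\<in>UNIV. pmf (conditional p a) b *\<^sub>R f (a, b) else 0)"
      using 2 by (simp add: sum_prod_UNIV level_kernel_def del: sum.delta sum.delta') (intro sum.cong, auto)
    thus ?thesis using 2 by (simp add: level_mean_def mean_def)
  next
    case 3
    have "(\<Sum>u\<in>UNIV. level_kernel p i z u *\<^sub>R f u) = (\<Sum>u\<in>UNIV. if u = z then f u else 0)"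
      using 3 by (intro sum.cong) (auto simp: level_kernel_def)
    thus ?thesis using 3 by (simp add: level_mean_def)
  qed (simp add: level_mean_def mean_def level_kernel_def)
qed

definition level_diff_kernel :: "('a::finite \<times> 'b::finite) pmf \<Rightarrow> nat \<Rightarrow> 'a \<times> 'b \<Rightarrow> 'a \<times> 'b \<Rightarrow> real" where
  "level_diff_kernel p i z u = level_kernel p i z u - (if i = 0 then 0 else level_kernel p (i - 1) z u)"

lemma level_diff_kernel: "level_diff p i f z = (\<Sum>u\<in>UNIV. level_diff_kernel p i z u *\<^sub>R f u)"
  by (simp add: level_diff_def level_diff_kernel_def level_mean_kernel scaleR_diff_left sum_subtractf)

lemma level_mean_sub: "level_mean p i (\<lambda>z. f z - g z) z = level_mean p i f z - level_mean p i g z"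
  by (simp add: level_mean_def mean_diff)

lemma level_diff_linear:
  "linear \<phi> \<Longrightarrow> level_diff p i (\<lambda>z. \<phi> (f z)) z = \<phi> (level_diff p i f z)"
  by (simp add: level_diff_kernel linear_sum linear_scale)

lemma level_diff_sum: "level_diff p i (\<lambda>z. \<Sum>k\<in>K. f k z) z = (\<Sum>k\<in>K. level_diff p i (f k) z)"
  by (simp add: level_diff_kernel scaleR_sum_right sum.swap[of _ K])

lemma level_diff_add: "level_diff p i (\<lambda>z. f z + g z) z = level_diff p i f z + level_diff p i g z"
  by (simp add: level_diff_kernel scaleR_add_right sum.distrib)

lemma level_diff_0: "level_diff p i (\<lambda>z. 0) z = 0"
  by (simp add: level_diff_kernel)

lemma level_diff_swap:
  "level_diff q j (\<lambda>y. level_diff p i (\<lambda>x. F x y) x) y = level_diff p i (\<lambda>x. level_diff q j (F x) y) x"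
  by (simp add: level_diff_kernel scaleR_sum_right mult.commute) (rule sum.swap)

lemma level_diff_level_mean_swap:
  "level_diff q j (\<lambda>y. level_mean p i (\<lambda>x. F x y) x) y = level_mean p i (\<lambda>x. level_diff q j (F x) y) x"
  by (simp add: level_diff_kernel level_mean_kernel scaleR_sum_right mult.commute) (rule sum.swap)

lemma level_mean_simps:
  "level_mean p 0 f = (\<lambda>z. mean p f)"
  "level_mean p 1 f = (\<lambda>z. mean (conditional p (fst z)) (\<lambda>y. f (fst z, y)))"
  "level_mean p 2 f = f"
  by (simp_all add: fun_eq_iff level_mean_def)

lemma mean_level_mean: "mean p (level_mean p i f) = mean p f"
proof -
  have "mean p (\<lambda>z. mean (conditional p (fst z)) (\<lambda>y. f (fst z, y))) = mean p f"
    unfolding mean_conditional[of p f]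
      mean_conditional[of p "\<lambda>z. mean (conditional p (fst z)) (\<lambda>y. f (fst z, y))"]
    by (simp add: mean_const)
  thus ?thesis
    by (cases "i = 0"; cases "i = 1") (simp_all add: level_mean_def[abs_def] mean_const)
qed

lemma level_cases:
  fixes i :: nat assumes "i \<le> 2" obtains "i = 0" | "i = 1" | "i = 2"
  using assms by linarith

text \<open>Tower property: the coarser of two nested conditionings prevails.\<close>

lemma level_mean_idem:
  assumes "i \<le> 2" "k \<le> 2"
  shows "level_mean p i (level_mean p k f) = level_mean p (min i k) f"
proof -
  \<comment> \<open>Level 0 after level 1 rests on this identity; the remaining pairs follow by
    unfolding.\<close>
  have "mean p (level_mean p 1 f) = mean p f" by (rule mean_level_mean)
  thus ?thesis
    using assms by (elim level_cases; simp add: level_mean_simps mean_const del: One_nat_def)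
qed

lemma level_diff_simps:
  "level_diff p 0 f = level_mean p 0 f"
  "level_diff p 1 f = (\<lambda>z. level_mean p 1 f z - level_mean p 0 f z)"
  "level_diff p 2 f = (\<lambda>z. level_mean p 2 f z - level_mean p 1 f z)"
  by (simp_all add: fun_eq_iff level_diff_def)

text \<open>The level differences are mutually annihilating projections, as expanding them with
  \<open>level_mean_idem\<close> shows. This later separates the components although each is built
  from its own operator ensemble.\<close>

lemma level_diff_idem:
  assumes "i \<le> 2" "k \<le> 2"
  shows "level_diff p i (level_diff p k f) z = (if i = k then level_diff p i f z else 0)"
  using assms(1) assms(2)
  by (elim level_cases; simp add: level_diff_simps level_mean_sub level_mean_idem del: One_nat_def)

text \<open>It lets an approximation of the level mean, which is all that a marginal of the state
  can provide, stand in for the function itself.\<close>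

lemma level_diff_level_mean:
  assumes "i \<le> 2" shows "level_diff p i (level_mean p i f) z = level_diff p i f z"
  using assms
  by (elim level_cases; simp add: level_diff_simps level_mean_sub level_mean_idem del: One_nat_def)

lemma sum_level_diff: "(\<Sum>i\<le>2. level_diff p i f z) = f z"
  by (simp add: numeral_2_eq_2 level_diff_def) (simp add: level_mean_def)

text \<open>Parseval's identity, read off from a codebook with a single cell: for
  \<open>L' = L = 1\<close> all level sizes are 1, and the average is \<open>f\<close> at that
  cell.\<close>

lemma mean_level_diff_norm_square:
  fixes f :: "_ \<Rightarrow> 'v::real_inner"
  assumes "i \<le> 2"
  shows "mean p (\<lambda>z. (norm (level_diff p i f z))\<^sup>2) \<le> mean p (\<lambda>z. (norm (f z))\<^sup>2)"
proof -
  have "(norm (sample 1 1 f c))\<^sup>2 = sample 1 1 (\<lambda>z. (norm (f z))\<^sup>2) c" for c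
    by (simp add: sample_def)
  hence "mean p (\<lambda>z. (norm (f z))\<^sup>2) = (\<Sum>i\<le>2. mean p (\<lambda>z. (norm (level_diff p i f z))\<^sup>2) / level_size 1 1 i)"
    using expectation_sample_norm_square[of 1 1 p f] expectation_sample[of 1 1 p "\<lambda>z. (norm (f z))\<^sup>2"] by simp
  also have "\<dots> = (\<Sum>i\<le>2. mean p (\<lambda>z. (norm (level_diff p i f z))\<^sup>2))"
  proof -
    have "level_size 1 1 i = 1" for i by (simp add: level_size_def)
    thus ?thesis by simp
  qed
  finally show ?thesis
    using member_le_sum[of i "{..2}" "\<lambda>i. mean p (\<lambda>z. (norm (level_diff p i f z))\<^sup>2)"] assms
    by (simp add: mean_nonneg)
qed

text \<open>A level mean has a nonnegative kernel and preserves the mean, so it contracts the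
  averaged trace norm; a difference of two such operators costs the factor 2.\<close>

lemma mean_trace_norm_level_diff:
  "mean p (\<lambda>z. trace_norm (level_diff p i f z)) \<le> (if i = 0 then 1 else 2) * mean p (\<lambda>z. trace_norm (f z))"
proof -
  have m: "trace_norm (level_mean p k f z) \<le> level_mean p k (\<lambda>z. trace_norm (f z)) z" for k z
    unfolding level_mean_kernel
    by (rule order.trans[OF trace_norm_sum]) (simp add: trace_norm_scaleR level_kernel_nonneg)
  have mm: "mean p (\<lambda>z. trace_norm (level_mean p k f z)) \<le> mean p (\<lambda>z. trace_norm (f z))" for k
  proof -
    have "mean p (\<lambda>z. trace_norm (level_mean p k f z)) \<le> mean p (level_mean p k (\<lambda>z. trace_norm (f z)))"
      by (intro mean_mono m)
    thus ?thesis by (simp only: mean_level_mean)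
  qed
  show ?thesis
  proof (cases "i = 0")
    case False
    have "mean p (\<lambda>z. trace_norm (level_diff p i f z)) \<le>
        mean p (\<lambda>z. trace_norm (level_mean p i f z) + trace_norm (level_mean p (i - 1) f z))"
      using False by (intro mean_mono) (simp add: level_diff_def trace_norm_diff)
    thus ?thesis using False mm[of i] mm[of "i - 1"] by (simp add: mean_add)
  qed (use mm[of 0] in \<open>simp add: level_diff_simps\<close>)
qed

subsection \<open>Pairs of codebooks\<close>

definition level_diff2 ::
  "('a::finite \<times> 'b::finite) pmf \<Rightarrow> ('c::finite \<times> 'd::finite) pmf \<Rightarrow> nat \<Rightarrow> nat \<Rightarrow>
   ('a \<times> 'b \<Rightarrow> 'c \<times> 'd \<Rightarrow> 'v::real_vector) \<Rightarrow> 'a \<times> 'b \<Rightarrow> 'c \<times> 'd \<Rightarrow> 'v" where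
  "level_diff2 p q i j F x y = level_diff p i (\<lambda>x. level_diff q j (F x) y) x"

definition level_mean2 ::
  "('a::finite \<times> 'b::finite) pmf \<Rightarrow> ('c::finite \<times> 'd::finite) pmf \<Rightarrow> nat \<Rightarrow> nat \<Rightarrow>
   ('a \<times> 'b \<Rightarrow> 'c \<times> 'd \<Rightarrow> 'v::real_vector) \<Rightarrow> 'a \<times> 'b \<Rightarrow> 'c \<times> 'd \<Rightarrow> 'v" where
  "level_mean2 p q i j F x y = level_mean p i (\<lambda>x. level_mean q j (F x) y) x"

lemma level_diff2_swap:
  "level_diff q j (\<lambda>y. level_diff p i (\<lambda>x. F x y) x) y = level_diff2 p q i j F x y"
  unfolding level_diff2_def by (rule level_diff_swap)

text \<open>Level operators on different codebooks commute, so the projections of each codebook can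
  be brought together and the rule for one codebook applied twice.\<close>

lemma level_diff2_idem:
  assumes "i \<le> 2" "j \<le> 2" "k \<le> 2" "l \<le> 2"
  shows "level_diff2 p q i j (level_diff2 p q k l F) x y = (if i = k \<and> j = l then level_diff2 p q i j F x y else 0)"
proof -
  have "level_diff2 p q i j (level_diff2 p q k l F) x y =
      level_diff p i (\<lambda>x. level_diff p k (\<lambda>x. level_diff q j (level_diff q l (F x)) y) x) x"
    unfolding level_diff2_def[abs_def] by (rule arg_cong[where f = "\<lambda>f. level_diff p i f x"]) (rule ext, rule level_diff_swap)
  also have "\<dots> = level_diff p i (level_diff p k (\<lambda>x. if j = l then level_diff q j (F x) y else 0)) x"
    by (simp only: level_diff_idem[OF assms(2,4)] eta_contract_eq)
  also have "\<dots> = (if i = k then level_diff p i (\<lambda>x. if j = l then level_diff q j (F x) y else 0) x else 0)"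
    by (rule level_diff_idem[OF assms(1,3)])
  finally show ?thesis by (simp add: level_diff2_def level_diff_0)
qed

lemma level_diff2_level_mean2:
  assumes "i \<le> 2" "j \<le> 2"
  shows "level_diff2 p q i j (level_mean2 p q i j F) x y = level_diff2 p q i j F x y"
proof -
  have "level_diff2 p q i j (level_mean2 p q i j F) x y =
      level_diff p i (level_mean p i (\<lambda>x. level_diff q j (level_mean q j (F x)) y)) x"
    unfolding level_diff2_def[abs_def] level_mean2_def[abs_def] level_diff_level_mean_swap ..
  thus ?thesis by (simp add: level_diff_level_mean assms level_diff2_def)
qed

lemma level_diff2_sum:
  "level_diff2 p q i j (\<lambda>x y. \<Sum>k\<in>K. F k x y) x y = (\<Sum>k\<in>K. level_diff2 p q i j (F k) x y)"
  by (simp add: level_diff2_def level_diff_sum)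

lemma level_diff2_add:
  "level_diff2 p q i j (\<lambda>x y. F x y + G x y) x y = level_diff2 p q i j F x y + level_diff2 p q i j G x y"
  by (simp add: level_diff2_def level_diff_add)

lemma level_diff2_linear:
  "linear \<phi> \<Longrightarrow> level_diff2 p q i j (\<lambda>x y. \<phi> (F x y)) x y = \<phi> (level_diff2 p q i j F x y)"
  by (simp add: level_diff2_def level_diff_linear[of \<phi>])

lemma sum_level_diff2: "(\<Sum>(i, j)\<in>{..2} \<times> {..2}. level_diff2 p q i j F x y) = F x y"
proof -
  have "(\<Sum>(i, j)\<in>{..2} \<times> {..2}. level_diff2 p q i j F x y) =
      (\<Sum>i\<le>2. level_diff p i (\<lambda>x. \<Sum>j\<le>2. level_diff q j (F x) y) x)"
    unfolding sum.cartesian_product' prod.case level_diff2_def level_diff_sum ..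
  thus ?thesis by (simp only: sum_level_diff)
qed

lemma level_diff2_0_0: "level_diff2 p q 0 0 F x y = mean p (\<lambda>x. mean q (F x))"
  by (simp add: level_diff2_def level_diff_simps level_mean_def)

text \<open>The contraction for one codebook is used twice, each time with the letters of the other
  held fixed.\<close>

lemma mean_level_diff2_norm_square:
  fixes F :: "_ \<Rightarrow> _ \<Rightarrow> 'v::real_inner"
  assumes "i \<le> 2" "j \<le> 2"
  shows "mean p (\<lambda>x. mean q (\<lambda>y. (norm (level_diff2 p q i j F x y))\<^sup>2)) \<le>
    mean p (\<lambda>x. mean q (\<lambda>y. (norm (F x y))\<^sup>2))"
proof -
  have "mean p (\<lambda>x. mean q (\<lambda>y. (norm (level_diff2 p q i j F x y))\<^sup>2)) =
      mean q (\<lambda>y. mean p (\<lambda>x. (norm (level_diff p i (\<lambda>x. level_diff q j (F x) y) x))\<^sup>2))"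
    unfolding level_diff2_def by (rule mean_swap)
  also have "\<dots> \<le> mean q (\<lambda>y. mean p (\<lambda>x. (norm (level_diff q j (F x) y))\<^sup>2))"
    by (intro mean_mono mean_level_diff_norm_square assms)
  also have "\<dots> = mean p (\<lambda>x. mean q (\<lambda>y. (norm (level_diff q j (F x) y))\<^sup>2))"
    by (rule mean_swap)
  also have "\<dots> \<le> mean p (\<lambda>x. mean q (\<lambda>y. (norm (F x y))\<^sup>2))"
    by (intro mean_mono mean_level_diff_norm_square assms)
  finally show ?thesis .
qed

lemma mean_trace_norm_level_diff2:
  "mean p (\<lambda>x. mean q (\<lambda>y. trace_norm (level_diff2 p q i j F x y))) \<le>
    (if i = 0 then 1 else 2) * (if j = 0 then 1 else 2) * mean p (\<lambda>x. mean q (\<lambda>y. trace_norm (F x y)))"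
proof -
  let ?c = "\<lambda>i::nat. if i = 0 then 1 else 2 :: real"
  have "mean p (\<lambda>x. mean q (\<lambda>y. trace_norm (level_diff2 p q i j F x y))) =
      mean q (\<lambda>y. mean p (\<lambda>x. trace_norm (level_diff p i (\<lambda>x. level_diff q j (F x) y) x)))"
    unfolding level_diff2_def by (rule mean_swap)
  also have "\<dots> \<le> mean q (\<lambda>y. ?c i * mean p (\<lambda>x. trace_norm (level_diff q j (F x) y)))"
    by (intro mean_mono mean_trace_norm_level_diff)
  also have "\<dots> = ?c i * mean p (\<lambda>x. mean q (\<lambda>y. trace_norm (level_diff q j (F x) y)))"
    unfolding mean_cmult by (subst mean_swap) (rule refl)
  also have "\<dots> \<le> ?c i * mean p (\<lambda>x. ?c j * mean q (\<lambda>y. trace_norm (F x y)))"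
    by (intro mult_left_mono mean_mono mean_trace_norm_level_diff) auto
  finally show ?thesis by (simp only: mean_cmult mult.assoc)
qed

section \<open>Averages over two independent codebooks\<close>

definition sample2 ::
  "nat \<Rightarrow> nat \<Rightarrow> nat \<Rightarrow> nat \<Rightarrow> ('a \<times> 'b \<Rightarrow> 'c \<times> 'd \<Rightarrow> 'v::real_vector) \<Rightarrow>
   (nat \<Rightarrow> 'a) \<times> (nat \<times> nat \<Rightarrow> 'b) \<Rightarrow> (nat \<Rightarrow> 'c) \<times> (nat \<times> nat \<Rightarrow> 'd) \<Rightarrow> 'v" where
  "sample2 L' L M' M F c d = sample L' L (\<lambda>x. sample M' M (F x) d) c"

lemma sample_linear: "linear \<phi> \<Longrightarrow> sample L' L (\<lambda>z. \<phi> (f z)) c = \<phi> (sample L' L f c)"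
  by (simp add: sample_def linear_sum linear_scale)

lemma sample_sum: "sample L' L (\<lambda>z. \<Sum>k\<in>K. f k z) c = (\<Sum>k\<in>K. sample L' L (f k) c)"
  by (simp add: sample_def scaleR_sum_right[symmetric] sum.swap[of _ K])

lemma sample_add: "sample L' L (\<lambda>z. f z + g z) c = sample L' L f c + sample L' L g c"
  by (simp add: sample_def scaleR_add_right sum.distrib)

lemma sample_scaleR: "sample L' L (\<lambda>z. r *\<^sub>R f z) c = r *\<^sub>R sample L' L f c"
  by (simp add: sample_def scaleR_sum_right[symmetric] mult.commute)

lemma sample_const: "0 < L' \<Longrightarrow> 0 < L \<Longrightarrow> sample L' L (\<lambda>z. k) c = k"
  by (simp add: sample_def sum_constant_scaleR)

lemma sample_mono: "(\<And>z. f z \<le> g z) \<Longrightarrow> sample L' L f c \<le> (sample L' L g c :: real)"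
  by (simp add: sample_def sum_mono divide_right_mono)

lemma trace_norm_sample: "trace_norm (sample L' L f c) \<le> sample L' L (\<lambda>z. trace_norm (f z)) c"
proof -
  have "trace_norm (\<Sum>a'=1..L'. \<Sum>a=1..L. f (fst c a', snd c (a', a))) \<le>
      (\<Sum>a'=1..L'. \<Sum>a=1..L. trace_norm (f (fst c a', snd c (a', a))))"
    by (intro order.trans[OF trace_norm_sum] sum_mono order.refl)
  thus ?thesis by (simp add: sample_def trace_norm_scaleR divide_right_mono)
qed

lemma level_diff_sample:
  "level_diff p i (\<lambda>x. sample L' L (F x) d) x = sample L' L (\<lambda>y. level_diff p i (\<lambda>x. F x y) x) d"
  by (simp add: level_diff_kernel sample_sum sample_scaleR)

lemma trace_norm_sample2: "trace_norm (sample2 L' L M' M F c d) \<le> sample2 L' L M' M (\<lambda>x y. trace_norm (F x y)) c d"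
  unfolding sample2_def by (intro order.trans[OF trace_norm_sample] sample_mono trace_norm_sample)

lemma expectation_pair:
  fixes f :: "'a \<Rightarrow> 'b \<Rightarrow> real"
  assumes P: "finite (set_pmf P)" and Q: "finite (set_pmf Q)"
  shows "measure_pmf.expectation (pair_pmf P Q) (\<lambda>(c, d). f c d) =
    measure_pmf.expectation Q (\<lambda>d. measure_pmf.expectation P (\<lambda>c. f c d))"
proof -
  have "measure_pmf.expectation (pair_pmf P Q) (\<lambda>(c, d). f c d) =
      (\<Sum>z\<in>set_pmf P \<times> set_pmf Q. (case z of (c, d) \<Rightarrow> f c d) * pmf (pair_pmf P Q) z)"
    by (rule integral_measure_pmf_real) (use P Q in auto)
  also have "\<dots> = (\<Sum>d\<in>set_pmf Q. \<Sum>c\<in>set_pmf P. f c d * pmf P c * pmf Q d)"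
    by (subst sum.swap) (simp add: sum.cartesian_product' pmf_pair mult.assoc)
  also have "\<dots> = (\<Sum>d\<in>set_pmf Q. measure_pmf.expectation P (\<lambda>c. f c d) * pmf Q d)"
    by (simp add: integral_measure_pmf_real[OF P] sum_distrib_right)
  also have "\<dots> = measure_pmf.expectation Q (\<lambda>d. measure_pmf.expectation P (\<lambda>c. f c d))"
    by (rule integral_measure_pmf_real[symmetric]) (use Q in auto)
  finally show ?thesis .
qed

context
  fixes p :: "('a::finite \<times> 'b::finite) pmf" and q :: "('c::finite \<times> 'd::finite) pmf"
    and L' L M' M :: nat
  assumes pos: "0 < L'" "0 < L" "0 < M'" "0 < M"
begin

abbreviation "codebooks \<equiv> pair_pmf (codebook p L' L) (codebook q M' M)"

lemma expectation_sample2: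
  fixes h :: "_ \<Rightarrow> _ \<Rightarrow> real"
  shows "measure_pmf.expectation codebooks (\<lambda>(c, d). sample2 L' L M' M h c d) = mean p (\<lambda>x. mean q (h x))"
  unfolding sample2_def expectation_pair[OF finite_set_codebook finite_set_codebook]
    expectation_sample[OF pos(1,2)] expectation_finite_mean[OF finite_set_codebook]
    expectation_sample[OF pos(3,4)] ..

text \<open>For a fixed second codebook the identity for one codebook applies in \<open>x\<close>.
  The resulting level differences are again averages over the second codebook, so the identity
  applies once more in \<open>y\<close>.\<close>

lemma expectation_sample2_norm_square:
  fixes F :: "_ \<Rightarrow> _ \<Rightarrow> 'v::real_inner"
  shows "measure_pmf.expectation codebooks (\<lambda>(c, d). (norm (sample2 L' L M' M F c d))\<^sup>2) =
    (\<Sum>(i, j)\<in>{..2} \<times> {..2}. mean p (\<lambda>x. mean q (\<lambda>y. (norm (level_diff2 p q i j F x y))\<^sup>2)) /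
       (level_size L' L i * level_size M' M j))"
proof -
  have "measure_pmf.expectation codebooks (\<lambda>(c, d). (norm (sample2 L' L M' M F c d))\<^sup>2) =
      measure_pmf.expectation (codebook q M' M) (\<lambda>d. \<Sum>i\<le>2.
        mean p (\<lambda>x. (norm (sample M' M (\<lambda>y. level_diff p i (\<lambda>x. F x y) x) d))\<^sup>2) / level_size L' L i)"
    unfolding sample2_def expectation_pair[OF finite_set_codebook finite_set_codebook]
      expectation_sample_norm_square[OF pos(1,2)] level_diff_sample ..
  also have "\<dots> = (\<Sum>i\<le>2. mean p (\<lambda>x. \<Sum>j\<le>2. mean q (\<lambda>y. (norm (level_diff2 p q i j F x y))\<^sup>2) /
      level_size M' M j) / level_size L' L i)"
    unfolding expectation_finite_sum[OF finite_set_codebook] integral_divide_zero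
      expectation_finite_mean[OF finite_set_codebook] expectation_sample_norm_square[OF pos(3,4)]
      level_diff2_swap ..
  also have "\<dots> = (\<Sum>i\<le>2. \<Sum>j\<le>2. mean p (\<lambda>x. mean q (\<lambda>y. (norm (level_diff2 p q i j F x y))\<^sup>2)) /
       (level_size L' L i * level_size M' M j))"
    unfolding mean_sum using mean_cmult[of p "1 / level_size M' M _"]
    by (simp add: sum_divide_distrib mult.commute)
  finally show ?thesis by (simp add: sum.cartesian_product')
qed

text \<open>Distinct pairs of levels are uncorrelated, whatever the operator ensembles \<open>A i j\<close>.\<close>

lemma expectation_sample2_norm_square_le:
  fixes A :: "_ \<Rightarrow> _ \<Rightarrow> _ \<Rightarrow> _ \<Rightarrow> 'v::real_inner"
  assumes J: "J \<subseteq> {..2} \<times> {..2}"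
  shows "measure_pmf.expectation codebooks
      (\<lambda>(c, d). (norm (sample2 L' L M' M (\<lambda>x y. \<Sum>(i, j)\<in>J. level_diff2 p q i j (A i j) x y) c d))\<^sup>2) \<le>
    (\<Sum>(i, j)\<in>J. mean p (\<lambda>x. mean q (\<lambda>y. (norm (A i j x y))\<^sup>2)) / (level_size L' L i * level_size M' M j))"
proof -
  let ?F = "\<lambda>x y. \<Sum>(i, j)\<in>J. level_diff2 p q i j (A i j) x y"
  have fin: "finite J" using J finite_subset by blast
  have F: "level_diff2 p q i j ?F x y = (if (i, j) \<in> J then level_diff2 p q i j (A i j) x y else 0)"
    if "(i, j) \<in> {..2} \<times> {..2}" for i j x y
  proof -
    have "level_diff2 p q i j ?F x y = (\<Sum>k\<in>J. level_diff2 p q i j (level_diff2 p q (fst k) (snd k) (A (fst k) (snd k))) x y)"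
      unfolding case_prod_beta by (rule level_diff2_sum)
    also have "\<dots> = (\<Sum>k\<in>J. if k = (i, j) then level_diff2 p q i j (A i j) x y else 0)"
      using J that by (intro sum.cong refl) (subst level_diff2_idem, auto)
    finally show ?thesis using fin by simp
  qed
  have sz: "0 \<le> level_size a b i" for a b i by (simp add: level_size_def)
  have "measure_pmf.expectation codebooks (\<lambda>(c, d). (norm (sample2 L' L M' M ?F c d))\<^sup>2) =
      (\<Sum>k\<in>{..2} \<times> {..2}. if k \<in> J then mean p (\<lambda>x. mean q (\<lambda>y.
        (norm (level_diff2 p q (fst k) (snd k) (A (fst k) (snd k)) x y))\<^sup>2)) /
         (level_size L' L (fst k) * level_size M' M (snd k)) else 0)"
    unfolding expectation_sample2_norm_square by (intro sum.cong refl) (auto simp: F mean_const)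
  also have "\<dots> = (\<Sum>k\<in>J. mean p (\<lambda>x. mean q (\<lambda>y.
        (norm (level_diff2 p q (fst k) (snd k) (A (fst k) (snd k)) x y))\<^sup>2)) /
         (level_size L' L (fst k) * level_size M' M (snd k)))"
    using J by (simp add: sum.inter_restrict[symmetric] Int_absorb1)
  \<comment> \<open>The projections are removed by contraction, since the entropies control only the
    ensembles themselves.\<close>
  also have "\<dots> \<le> (\<Sum>k\<in>J. mean p (\<lambda>x. mean q (\<lambda>y. (norm (A (fst k) (snd k) x y))\<^sup>2)) /
         (level_size L' L (fst k) * level_size M' M (snd k)))"
    using J by (intro sum_mono divide_right_mono mean_level_diff2_norm_square mult_nonneg_nonneg sz) auto
  finally show ?thesis by (simp add: case_prod_beta)
qed

end

subsection \<open>The covering bound\<close>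

lemma mean_pair: "mean (pair_pmf p q) f = mean p (\<lambda>x. mean q (\<lambda>y. f (x, y)))"
  by (simp add: mean_def sum_prod_UNIV pmf_pair scaleR_sum_right)

text \<open>The fibres of \<open>w\<close> are rectangles, so the fibre identity for one codebook
  can be used in each coordinate.\<close>

lemma level_mean2_fibre:
  fixes p :: "('a::finite \<times> 'b::finite) pmf" and q :: "('c::finite \<times> 'd::finite) pmf"
  assumes w: "\<And>u v x y. w (u, v) = w (x, y) \<longleftrightarrow> same_level i u x \<and> same_level j v y"
  shows "(\<Sum>z' | w z' = w z. pmf (pair_pmf p q) z') *\<^sub>R level_mean2 p q i j F (fst z) (snd z) =
    (\<Sum>z' | w z' = w z. pmf (pair_pmf p q) z' *\<^sub>R F (fst z') (snd z'))"
proof -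
  obtain x y where z: "z = (x, y)" by (cases z)
  let ?X = "{u. same_level i u x}" and ?Y = "{v. same_level j v y}"
  have fib: "{z'. w z' = w z} = ?X \<times> ?Y"
    by (rule set_eqI, rename_tac t, case_tac t) (simp add: z w )
  have "(\<Sum>z' | w z' = w z. pmf (pair_pmf p q) z' *\<^sub>R F (fst z') (snd z')) =
      (\<Sum>u\<in>?X. pmf p u *\<^sub>R (\<Sum>v\<in>?Y. pmf q v *\<^sub>R F u v))"
    unfolding fib by (simp add: sum.cartesian_product' pmf_pair scaleR_sum_right)
  also have "\<dots> = (\<Sum>u\<in>?X. pmf p u *\<^sub>R ((\<Sum>v\<in>?Y. pmf q v) *\<^sub>R level_mean q j (F u) y))"
    by (simp only: level_mean_fibre)
  also have "\<dots> = (\<Sum>v\<in>?Y. pmf q v) *\<^sub>R (\<Sum>u\<in>?X. pmf p u *\<^sub>R level_mean q j (F u) y)"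
    by (simp add: scaleR_sum_right mult.commute)
  also have "\<dots> = (\<Sum>v\<in>?Y. pmf q v) *\<^sub>R ((\<Sum>u\<in>?X. pmf p u) *\<^sub>R level_mean2 p q i j F x y)"
    by (simp only: level_mean_fibre level_mean2_def)
  also have "\<dots> = (\<Sum>z' | w z' = w z. pmf (pair_pmf p q) z') *\<^sub>R level_mean2 p q i j F x y"
    unfolding fib by (simp add: sum.cartesian_product' pmf_pair sum_product[symmetric] mult.commute)
  finally show ?thesis by (simp add: z)
qed

text \<open>Tracing out classical letters only coarsens the label from \<open>h z\<close> to
  \<open>w z\<close>: in the sum over \<open>r\<close> just \<open>r = rest z\<close> survives.
  Keeping \<open>glue\<close> and \<open>full\<close> abstract lets one lemma serve all seven proper
  marginals.\<close>

lemma ptrace_cq_classical: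
  fixes h :: "'z::finite \<Rightarrow> 'n::finite" and w :: "'z \<Rightarrow> 'w::finite" and rest :: "'z \<Rightarrow> 'r::finite"
  assumes glue: "\<And>v k r. glue ((v, k), r) = (full v r, k)"
    and full: "\<And>v r z. h z = full v r \<longleftrightarrow> w z = v \<and> rest z = r"
  shows "ptrace glue (\<Sum>z\<in>UNIV. c z *\<^sub>R tensor (basis_proj (h z)) (s z)) =
    (\<Sum>z\<in>UNIV. c z *\<^sub>R tensor (basis_proj (w z)) (s z))"
proof -
  have "ptrace glue (\<Sum>z\<in>UNIV. c z *\<^sub>R tensor (basis_proj (h z)) (s z)) $ (u, k) $ (v, l) =
      (\<Sum>z\<in>UNIV. c z *\<^sub>R tensor (basis_proj (w z)) (s z)) $ (u, k) $ (v, l)" for u k v l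
  proof -
    have "ptrace glue (\<Sum>z\<in>UNIV. c z *\<^sub>R tensor (basis_proj (h z)) (s z)) $ (u, k) $ (v, l) =
      (\<Sum>z\<in>UNIV. \<Sum>r\<in>UNIV. if r = rest z then if w z = u \<and> w z = v then (c z *\<^sub>R s z) $ k $ l else 0 else 0)"
      by (subst sum.swap)
         (auto simp: ptrace_def glue tensor_def basis_proj_def full eq_commute[of "full _ _"] intro!: sum.cong)
    also have "\<dots> = (\<Sum>z\<in>UNIV. if w z = u \<and> w z = v then (c z *\<^sub>R s z) $ k $ l else 0)"
      by simp
    also have "\<dots> = (\<Sum>z\<in>UNIV. c z *\<^sub>R tensor (basis_proj (w z)) (s z)) $ (u, k) $ (v, l)"
      by (auto simp: tensor_def basis_proj_def intro!: sum.cong)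
    finally show ?thesis .
  qed
  thus ?thesis by (simp add: vec_eq_iff)
qed

lemma cmg_state_eq:
  fixes pX :: "('x1::finite \<times> 'x::finite) pmf" and pY :: "('y1::finite \<times> 'y::finite) pmf"
  shows "cmg_state pX pY \<sigma>E = (\<Sum>z\<in>UNIV. pmf (pair_pmf pX pY) z *\<^sub>R
    tensor (basis_proj (case z of ((x', x), (y', y)) \<Rightarrow> (x', x, y', y)))
      (\<sigma>E (fst (fst z)) (snd (fst z)) (fst (snd z)) (snd (snd z))))"
  by (simp add: cmg_state_def sum_prod_UNIV pmf_pair)

lemma supported_subspace: "subspace {A. supported V e A}"
  by (auto simp: subspace_def supported_def linear_0[OF similar_linear] linear_add[OF similar_linear]
      linear_scale[OF similar_linear])

text \<open>Positivity is complete positivity with a one-dimensional ancilla.\<close>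

lemma channel_state:
  fixes N :: "('a::finite \<times> 'b::finite) op \<Rightarrow> 'e::finite op"
  assumes N: "channel N" and A: "density_op A" and B: "density_op B"
  shows "psd (N (tensor A B))" "Re (trace (N (tensor A B))) \<le> 1"
proof -
  have T: "psd (tensor A B)" using A B psd_tensor by (auto simp: density_op_def)
  have blocks: "psd_blocks 1 (\<lambda>_ _. X) \<longleftrightarrow> psd X" for X :: "'n::finite op"
  proof
    assume *: "psd_blocks 1 (\<lambda>_ _. X)"
    show "psd X" unfolding psd_def
    proof
      fix v show "cinner v (X *v v) \<in> \<real>\<^sub>\<ge>\<^sub>0"
        using *[unfolded psd_blocks_def, rule_format, of "\<lambda>_. v"] by simp
    qed
  qed (simp add: psd_blocks_def psd_def)
  have "psd_blocks 1 (\<lambda>_ _. tensor A B)" using T blocks by blast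
  hence "psd_blocks 1 (\<lambda>_ _. N (tensor A B))"
    using N unfolding channel_def completely_positive_def by blast
  thus "psd (N (tensor A B))" using blocks by blast
  have "Re (trace (N (tensor A B))) \<le> Re (trace (tensor A B))"
    using N T unfolding channel_def trace_nonincreasing_def by blast
  thus "Re (trace (N (tensor A B))) \<le> 1"
    using A B by (simp add: density_op_def trace_tensor)
qed

section \<open>Smoothing each component and adding up the errors\<close>

context
  fixes p :: "('a::finite \<times> 'b::finite) pmf" and q :: "('c::finite \<times> 'd::finite) pmf"
    and s :: "'a \<times> 'b \<Rightarrow> 'c \<times> 'd \<Rightarrow> 'e::finite op"
    and L' L M' M :: nat and \<epsilon> :: real and V :: "'e op" and e :: "'e \<Rightarrow> real"
  assumes pos: "0 < L'" "0 < L" "0 < M'" "0 < M"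
    and eps: "0 < \<epsilon>"
    and s: "\<And>x y. psd (s x y)" "\<And>x y. Re (trace (s x y)) \<le> 1"
    and V: "unitary V" "mean p (\<lambda>x. mean q (s x)) = V ** real_diag e ** dagger V"
begin

text \<open>The last bound is scaled by the number of independent draws: after division each pair of
  levels contributes at most \<open>\<epsilon>\<^sup>2\<close> to the second moment.\<close>

definition approximates :: "nat \<Rightarrow> nat \<Rightarrow> ('a \<times> 'b \<Rightarrow> 'c \<times> 'd \<Rightarrow> 'e op) \<Rightarrow> bool" where
  "approximates i j A \<longleftrightarrow> (\<forall>x y. supported V e (A x y)) \<and>
    mean p (\<lambda>x. mean q (\<lambda>y. trace_norm (level_mean2 p q i j s x y - A x y))) \<le> \<epsilon> \<and>
    mean p (\<lambda>x. mean q (\<lambda>y. (norm (weighted V e (A x y)))\<^sup>2)) \<le>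
      \<epsilon>\<^sup>2 * (level_size L' L i * level_size M' M j)"

text \<open>The label \<open>w\<close> stands for the classical systems that are kept; its fibres
  are the classes over which \<open>level_mean2\<close> averages.\<close>

lemma smooth_I2_approximates:
  fixes w :: "('a \<times> 'b) \<times> ('c \<times> 'd) \<Rightarrow> 'w::finite"
  assumes w: "\<And>u v x y. w (u, v) = w (x, y) \<longleftrightarrow> same_level i u x \<and> same_level j v y"
    and \<tau>: "\<tau> = (\<Sum>z\<in>UNIV. pmf (pair_pmf p q) z *\<^sub>R tensor (basis_proj (w z)) (s (fst z) (snd z)))"
    and I2: "smooth_I2 \<epsilon> \<tau> + ereal (log 2 (1 / \<epsilon>\<^sup>2)) < ereal (log 2 (level_size L' L i * level_size M' M j))"
  shows "\<exists>A. approximates i j A"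
proof -
  have sz: "0 < level_size L' L i * level_size M' M j"
    using pos by (simp add: level_size_def)
  have m: "(\<Sum>z\<in>UNIV. pmf (pair_pmf p q) z *\<^sub>R s (fst z) (snd z)) = V ** real_diag e ** dagger V"
    using mean_pair[of p q "\<lambda>z. s (fst z) (snd z)"] V(2) by (simp add: mean_def)
  have "\<exists>A. (\<forall>z. supported V e (A z)) \<and>
    (\<Sum>z\<in>UNIV. pmf (pair_pmf p q) z * trace_norm (level_mean2 p q i j s (fst z) (snd z) - A z)) \<le> \<epsilon> \<and>
    (\<Sum>z\<in>UNIV. pmf (pair_pmf p q) z * (norm (weighted V e (A z)))\<^sup>2) \<le> \<epsilon>\<^sup>2 * (level_size L' L i * level_size M' M j)"
    by (rule smooth_I2_blocks[where s = "\<lambda>z. s (fst z) (snd z)",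
          OF _ _ \<tau> V(1) m I2 sz eps level_mean2_fibre[where F = s, OF w]]) (rule s)+
  then obtain A where A: "\<And>z. supported V e (A z)"
    "(\<Sum>z\<in>UNIV. pmf (pair_pmf p q) z * trace_norm (level_mean2 p q i j s (fst z) (snd z) - A z)) \<le> \<epsilon>"
    "(\<Sum>z\<in>UNIV. pmf (pair_pmf p q) z * (norm (weighted V e (A z)))\<^sup>2) \<le> \<epsilon>\<^sup>2 * (level_size L' L i * level_size M' M j)"
    by blast
  have "approximates i j (\<lambda>x y. A (x, y))"
    using A mean_pair[of p q "\<lambda>z. trace_norm (level_mean2 p q i j s (fst z) (snd z) - A z)"]
      mean_pair[of p q "\<lambda>z. (norm (weighted V e (A z)))\<^sup>2"]
    by (simp add: approximates_def mean_def)
  thus ?thesis by blast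
qed

lemma smooth_I2_marginal_approximates:
  fixes h :: "('a \<times> 'b) \<times> ('c \<times> 'd) \<Rightarrow> 'n::finite" and w :: "('a \<times> 'b) \<times> ('c \<times> 'd) \<Rightarrow> 'w::finite"
    and rest :: "('a \<times> 'b) \<times> ('c \<times> 'd) \<Rightarrow> 'r::finite"
  assumes \<sigma>: "\<sigma> = (\<Sum>z\<in>UNIV. pmf (pair_pmf p q) z *\<^sub>R tensor (basis_proj (h z)) (s (fst z) (snd z)))"
    and I2: "smooth_I2 \<epsilon> (ptrace glue \<sigma>) + ereal (log 2 (1 / \<epsilon>\<^sup>2)) < ereal (log 2 (level_size L' L i * level_size M' M j))"
    and w: "\<And>u v x y. w (u, v) = w (x, y) \<longleftrightarrow> same_level i u x \<and> same_level j v y"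
    and glue: "\<And>v k r. glue ((v, k), r) = (full v r, k)"
    and full: "\<And>v r z. h z = full v r \<longleftrightarrow> w z = v \<and> rest z = r"
  shows "\<exists>A. approximates i j A"
  by (rule smooth_I2_approximates[OF w _ I2])
     (simp_all only: \<sigma> ptrace_cq_classical[where glue = glue and full = full and h = h, OF glue full])

lemma covering_bound:
  assumes A: "\<And>i j. i \<le> 2 \<Longrightarrow> j \<le> 2 \<Longrightarrow> (i, j) \<noteq> (0, 0) \<Longrightarrow> \<exists>A. approximates i j A"
  shows "measure_pmf.expectation (pair_pmf (codebook p L' L) (codebook q M' M))
    (\<lambda>(c, d). trace_norm (sample2 L' L M' M s c d - mean p (\<lambda>x. mean q (s x)))) \<le> 57 / 2 * \<epsilon>"
proof -
  \<comment> \<open>The component at \<open>(0, 0)\<close> is the mean, which is subtracted.\<close>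
  define J :: "(nat \<times> nat) set" where "J = {..2} \<times> {..2} - {(0, 0)}"
  have fJ: "finite J" and JJ: "J \<subseteq> {..2} \<times> {..2}" by (auto simp: J_def)
  have "\<forall>i j. \<exists>A. (i, j) \<in> J \<longrightarrow> approximates i j A"
    using A by (auto simp: J_def)
  then obtain A where A: "\<And>i j. (i, j) \<in> J \<Longrightarrow> approximates i j (A i j)"
    by metis
  define D where "D i j x y = level_mean2 p q i j s x y - A i j x y" for i j x y
  define Z where "Z x y = (\<Sum>(i, j)\<in>J. level_diff2 p q i j (A i j) x y)" for x y
  define E where "E = (\<lambda>f. measure_pmf.expectation (pair_pmf (codebook p L' L) (codebook q M' M)) (\<lambda>(c, d). f c d :: real))"
  let ?S = "sample2 L' L M' M"
  have fin: "finite (set_pmf (pair_pmf (codebook p L' L) (codebook q M' M)))"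
    by (simp add: finite_set_codebook)
  \<comment> \<open>A component of \<open>s\<close> does not change when \<open>s\<close> is
    replaced by its level mean, which is the smoothing error \<open>D\<close> plus the ensemble
    \<open>A\<close>.\<close>
  have dec: "s x y - mean p (\<lambda>x. mean q (s x)) = (\<Sum>(i, j)\<in>J. level_diff2 p q i j (D i j) x y) + Z x y" for x y
  proof -
    have "level_diff2 p q i j s x y = level_diff2 p q i j (D i j) x y + level_diff2 p q i j (A i j) x y"
      if "(i, j) \<in> J" for i j
      using that JJ level_diff2_level_mean2[of i j p q s x y] level_diff2_add[of p q i j "D i j" "A i j" x y]
      by (auto simp: D_def)
    hence "(\<Sum>(i, j)\<in>J. level_diff2 p q i j s x y) = (\<Sum>(i, j)\<in>J. level_diff2 p q i j (D i j) x y) + Z x y"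
      unfolding Z_def sum.distrib[symmetric] by (intro sum.cong) auto
    moreover have "(\<Sum>(i, j)\<in>J. level_diff2 p q i j s x y) = s x y - mean p (\<lambda>x. mean q (s x))"
      using sum_level_diff2[of p q s x y] by (simp add: J_def sum_diff1 level_diff2_0_0)
    ultimately show ?thesis by simp
  qed
  \<comment> \<open>A constant is its own codebook average, as the codebooks are nonempty.\<close>
  have "?S s c d - mean p (\<lambda>x. mean q (s x)) =
      ?S (\<lambda>x y. s x y - mean p (\<lambda>x. mean q (s x))) c d" for c d
  proof -
    have "?S s c d = ?S (\<lambda>x y. (s x y - mean p (\<lambda>x. mean q (s x))) + mean p (\<lambda>x. mean q (s x))) c d" by simp
    also have "\<dots> = ?S (\<lambda>x y. s x y - mean p (\<lambda>x. mean q (s x))) c d + mean p (\<lambda>x. mean q (s x))"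
      unfolding sample2_def sample_add by (simp add: sample_const pos)
    finally show ?thesis by simp
  qed
  hence dev: "?S s c d - mean p (\<lambda>x. mean q (s x)) =
      (\<Sum>(i, j)\<in>J. ?S (level_diff2 p q i j (D i j)) c d) + ?S Z c d" for c d
    unfolding dec sample2_def sample_add case_prod_beta sample_sum by simp
  \<comment> \<open>The support condition of \<open>trace_norm_le_weighted\<close> defines a
    subspace, so it passes through level differences and codebook averages.\<close>
  have suppZ: "supported V e (?S Z c d)" for c d
  proof -
    note S = supported_subspace[of V e]
    have "A (fst k) (snd k) x y \<in> {A. supported V e A}" if "k \<in> J" for k x y
      using A[of "fst k" "snd k"] that by (simp add: approximates_def del: split_paired_All)
    hence "Z x y \<in> {A. supported V e A}" for x y
      unfolding Z_def case_prod_beta level_diff2_def level_diff_kernel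
      by (intro subspace_sum[OF S] subspace_scale[OF S])
    hence "?S Z c d \<in> {A. supported V e A}"
      unfolding sample2_def sample_def by (intro subspace_sum[OF S] subspace_scale[OF S])
    thus ?thesis by simp
  qed
  have e0: "0 \<le> e k" for k
  proof (rule psd_eigenvalues[OF _ V(1)])
    show "psd (V ** real_diag e ** dagger V)"
      unfolding V(2)[symmetric] mean_def by (intro psd_sum psd_scaleR s) auto
  qed
  have e1: "(\<Sum>k\<in>UNIV. e k) \<le> 1"
  proof -
    have "(\<Sum>k\<in>UNIV. e k) = Re (trace (V ** real_diag e ** dagger V))"
      using trace_similar[OF unitary_dagger[OF V(1)], of "real_diag e"] by (simp add: trace_def real_diag_def)
    also have "\<dots> = mean p (\<lambda>x. mean q (\<lambda>y. Re (trace (s x y))))"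
      unfolding V(2)[symmetric] by (simp add: mean_def trace_sum trace_scaleR)
    also have "\<dots> \<le> mean p (\<lambda>x. mean q (\<lambda>y. 1))" by (intro mean_mono s)
    finally show ?thesis by (simp add: mean_const)
  qed
  define F where "F x y = (\<Sum>(i, j)\<in>J. level_diff2 p q i j (\<lambda>x y. weighted V e (A i j x y)) x y)" for x y
  have F: "weighted V e (?S Z c d) = ?S F c d" for c d
    unfolding sample2_def sample_linear[OF weighted_linear, symmetric] Z_def F_def case_prod_beta
      linear_sum[OF weighted_linear] level_diff2_linear[OF weighted_linear] ..
  \<comment> \<open>Pointwise in the codebooks the squared norm enters linearly, so its expectation
    can be inserted later without a concavity argument.\<close>
  have bound: "trace_norm (?S s c d - mean p (\<lambda>x. mean q (s x))) \<le>
      (\<Sum>(i, j)\<in>J. ?S (\<lambda>x y. trace_norm (level_diff2 p q i j (D i j) x y)) c d) +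
      (\<epsilon> / 2 + (norm (?S F c d))\<^sup>2 / (2 * \<epsilon>))" for c d
  proof -
    have "trace_norm (\<Sum>(i, j)\<in>J. ?S (level_diff2 p q i j (D i j)) c d) \<le>
        (\<Sum>(i, j)\<in>J. ?S (\<lambda>x y. trace_norm (level_diff2 p q i j (D i j) x y)) c d)"
      unfolding case_prod_beta by (intro order.trans[OF trace_norm_sum] sum_mono trace_norm_sample2)
    moreover have "trace_norm (?S Z c d) \<le> (\<epsilon> * (\<Sum>k\<in>UNIV. e k) + (norm (?S F c d))\<^sup>2 / \<epsilon>) / 2"
      using trace_norm_le_weighted[OF V(1) e0 suppZ eps] by (simp add: F)
    moreover have "(\<epsilon> * (\<Sum>k\<in>UNIV. e k) + (norm (?S F c d))\<^sup>2 / \<epsilon>) / 2 \<le>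
        \<epsilon> / 2 + (norm (?S F c d))\<^sup>2 / (2 * \<epsilon>)"
      using mult_left_mono[OF e1, of \<epsilon>] eps by (simp add: add_divide_distrib mult.commute)
    ultimately show ?thesis
      unfolding dev by (meson add_mono order.trans trace_norm_triangle)
  qed
  have weights: "(\<Sum>(i, j)\<in>J. (if i = 0 then 1 else 2) * (if j = 0 then 1 else 2) * \<epsilon>) = 24 * \<epsilon>"
    unfolding J_def by (simp add: sum_diff1 sum.cartesian_product' numeral_2_eq_2)
  have card: "card J = 8"
    by (simp add: J_def card_Diff_singleton)
  have sum1: "E (\<lambda>c d. \<Sum>(i, j)\<in>J. ?S (\<lambda>x y. trace_norm (level_diff2 p q i j (D i j) x y)) c d) \<le> 24 * \<epsilon>"
  proof -
    have "E (\<lambda>c d. \<Sum>(i, j)\<in>J. ?S (\<lambda>x y. trace_norm (level_diff2 p q i j (D i j) x y)) c d) =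
        (\<Sum>(i, j)\<in>J. mean p (\<lambda>x. mean q (\<lambda>y. trace_norm (level_diff2 p q i j (D i j) x y))))"
      by (simp only: E_def case_prod_beta' expectation_finite_sum[OF fin]
          expectation_sample2[OF pos, where p = p and q = q, unfolded case_prod_beta'])
    also have "\<dots> \<le> (\<Sum>(i, j)\<in>J. (if i = 0 then 1 else 2) * (if j = 0 then 1 else 2) * \<epsilon>)"
    proof (rule sum_mono, clarify)
      fix i j assume "(i, j) \<in> J"
      hence "mean p (\<lambda>x. mean q (\<lambda>y. trace_norm (D i j x y))) \<le> \<epsilon>"
        using A unfolding approximates_def D_def by blast
      thus "mean p (\<lambda>x. mean q (\<lambda>y. trace_norm (level_diff2 p q i j (D i j) x y))) \<le>
          (if i = 0 then 1 else 2) * (if j = 0 then 1 else 2) * \<epsilon>"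
        by (intro order.trans[OF mean_trace_norm_level_diff2] mult_left_mono) auto
    qed
    finally show ?thesis using weights by simp
  qed
  have sum2: "E (\<lambda>c d. (norm (?S F c d))\<^sup>2) \<le> 8 * \<epsilon>\<^sup>2"
  proof -
    have "E (\<lambda>c d. (norm (?S F c d))\<^sup>2) \<le> (\<Sum>(i, j)\<in>J. mean p (\<lambda>x. mean q (\<lambda>y. (norm (weighted V e (A i j x y)))\<^sup>2)) /
        (level_size L' L i * level_size M' M j))"
      using expectation_sample2_norm_square_le[OF pos JJ, where p = p and q = q and A = "\<lambda>i j x y. weighted V e (A i j x y)"]
      by (simp add: E_def F_def[abs_def])
    also have "\<dots> \<le> (\<Sum>(i, j)\<in>J. \<epsilon>\<^sup>2)"
    proof (rule sum_mono, clarify)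
      fix i j assume "(i, j) \<in> J"
      moreover have "0 < level_size L' L i * level_size M' M j" using pos by (simp add: level_size_def)
      ultimately show "mean p (\<lambda>x. mean q (\<lambda>y. (norm (weighted V e (A i j x y)))\<^sup>2)) /
          (level_size L' L i * level_size M' M j) \<le> \<epsilon>\<^sup>2"
        using A unfolding approximates_def by (simp add: pos_divide_le_eq)
    qed
    also have "\<dots> = 8 * \<epsilon>\<^sup>2" by (simp add: card)
    finally show ?thesis .
  qed
  have "E (\<lambda>c d. trace_norm (?S s c d - mean p (\<lambda>x. mean q (s x)))) \<le>
      E (\<lambda>c d. (\<Sum>(i, j)\<in>J. ?S (\<lambda>x y. trace_norm (level_diff2 p q i j (D i j) x y)) c d) +
      (\<epsilon> / 2 + (norm (?S F c d))\<^sup>2 / (2 * \<epsilon>)))"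
    unfolding E_def by (intro expectation_finite_mono fin) (use bound in auto)
  also have "\<dots> = E (\<lambda>c d. \<Sum>(i, j)\<in>J. ?S (\<lambda>x y. trace_norm (level_diff2 p q i j (D i j) x y)) c d) +
      (\<epsilon> / 2 + E (\<lambda>c d. (norm (?S F c d))\<^sup>2) / (2 * \<epsilon>))"
    unfolding E_def case_prod_beta expectation_finite_add[OF fin] by simp
  \<comment> \<open>In units of \<epsilon>: 24 for smoothing, 1/2 from the trace of the mean state,
    and 8/2 from the second moment.\<close>
  also have "\<dots> \<le> 24 * \<epsilon> + (\<epsilon> / 2 + 8 * \<epsilon>\<^sup>2 / (2 * \<epsilon>))"
    using eps by (intro add_mono sum1 divide_right_mono sum2) auto
  also have "\<dots> = 57 / 2 * \<epsilon>" using eps by (simp add: power2_eq_square)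
  finally show ?thesis by (simp add: E_def)
qed

end

theorem lemma2:
  fixes \<epsilon> :: real
    and N :: "('a::finite \<times> 'b::finite) op \<Rightarrow> 'e::finite op"
    and \<rho>A :: "'x::finite \<Rightarrow> 'a op" and \<rho>B :: "'y::finite \<Rightarrow> 'b op"
    and pX :: "('x1::finite \<times> 'x) pmf" and pY :: "('y1::finite \<times> 'y) pmf"
    and \<sigma>E :: "'x1 \<Rightarrow> 'x \<Rightarrow> 'y1 \<Rightarrow> 'y \<Rightarrow> 'e op"
    and \<sigma> :: "(('x1 \<times> 'x \<times> 'y1 \<times> 'y) \<times> 'e) op"
    and L' L M' M :: nat
  assumes eps: "0 < \<epsilon>" "\<epsilon> < 1"
    and N: "channel N"
    and \<rho>A: "\<And>x. density_op (\<rho>A x)"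
    and \<rho>B: "\<And>y. density_op (\<rho>B y)"
    and \<sigma>E: "\<And>x' x y' y. \<sigma>E x' x y' y = N (tensor (\<rho>A x) (\<rho>B y))"
    and \<sigma>: "\<sigma> = cmg_state pX pY \<sigma>E"
    and pos: "0 < L'" "0 < L" "0 < M'" "0 < M"
    and X': "ereal (log 2 L')
      > smooth_I2 \<epsilon> (ptrace (\<lambda>((x', e), (x, y', y)). ((x', x, y', y), e)) \<sigma>)
        + ereal (log 2 (1 / \<epsilon>\<^sup>2))"
    and Y': "ereal (log 2 M')
      > smooth_I2 \<epsilon> (ptrace (\<lambda>((y', e), (x', x, y)). ((x', x, y', y), e)) \<sigma>)
        + ereal (log 2 (1 / \<epsilon>\<^sup>2))"
    and X'X: "ereal (log 2 L' + log 2 L)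
      > smooth_I2 \<epsilon> (ptrace (\<lambda>(((x', x), e), (y', y)). ((x', x, y', y), e)) \<sigma>)
        + ereal (log 2 (1 / \<epsilon>\<^sup>2))"
    and Y'Y: "ereal (log 2 M' + log 2 M)
      > smooth_I2 \<epsilon> (ptrace (\<lambda>(((y', y), e), (x', x)). ((x', x, y', y), e)) \<sigma>)
        + ereal (log 2 (1 / \<epsilon>\<^sup>2))"
    and X'Y': "ereal (log 2 L' + log 2 M')
      > smooth_I2 \<epsilon> (ptrace (\<lambda>(((x', y'), e), (x, y)). ((x', x, y', y), e)) \<sigma>)
        + ereal (log 2 (1 / \<epsilon>\<^sup>2))"
    and X'Y'Y: "ereal (log 2 L' + log 2 M' + log 2 M)
      > smooth_I2 \<epsilon> (ptrace (\<lambda>(((x', y', y), e), x). ((x', x, y', y), e)) \<sigma>)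
        + ereal (log 2 (1 / \<epsilon>\<^sup>2))"
    and X'XY': "ereal (log 2 L' + log 2 M' + log 2 L)
      > smooth_I2 \<epsilon> (ptrace (\<lambda>(((x', x, y'), e), y). ((x', x, y', y), e)) \<sigma>)
        + ereal (log 2 (1 / \<epsilon>\<^sup>2))"
    and X'XY'Y: "ereal (log 2 L' + log 2 M' + log 2 L + log 2 M)
      > smooth_I2 \<epsilon> \<sigma> + ereal (log 2 (1 / \<epsilon>\<^sup>2))"
  shows "CMG pX pY \<sigma>E L' L M' M < 31 * \<epsilon>"
proof -
  define s where "s x y = \<sigma>E (fst x) (snd x) (fst y) (snd y)" for x y
  define h :: "('x1 \<times> 'x) \<times> ('y1 \<times> 'y) \<Rightarrow> 'x1 \<times> 'x \<times> 'y1 \<times> 'y"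
    where "h z = (case z of ((x', x), (y', y)) \<Rightarrow> (x', x, y', y))" for z
  have s: "psd (s x y)" "Re (trace (s x y)) \<le> 1" for x y
    unfolding s_def \<sigma>E using channel_state[OF N \<rho>A \<rho>B] by auto
  have \<sigma>': "\<sigma> = (\<Sum>z\<in>UNIV. pmf (pair_pmf pX pY) z *\<^sub>R tensor (basis_proj (h z)) (s (fst z) (snd z)))"
    unfolding \<sigma> cmg_state_eq h_def s_def ..
  define \<mu> where "\<mu> = mean pX (\<lambda>x. mean pY (s x))"
  have \<mu>: "ptrace (\<lambda>(e, w). (w, e)) \<sigma> = \<mu>"
    unfolding \<sigma>' ptrace_cq_quantum \<mu>_def
    using mean_pair[of pX pY "\<lambda>z. s (fst z) (snd z)"] by (simp add: mean_def)
  have psd_\<mu>: "psd \<mu>"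
    unfolding \<mu>_def mean_def by (intro psd_sum psd_scaleR s) auto
  obtain V e where V: "unitary V" "\<mu> = V ** real_diag e ** dagger V"
    using hermitian_diagonalisation[OF psd_hermitian[OF psd_\<mu>]] .
  let ?ap = "\<lambda>i j. \<exists>A. approximates pX pY s L' L M' M \<epsilon> V e i j A"
  note approx = smooth_I2_approximates[where s = s, OF pos eps(1) s V(1) V(2)[unfolded \<mu>_def]]
  note marginal = smooth_I2_marginal_approximates[where s = s,
      OF pos eps(1) s V(1) V(2)[unfolded \<mu>_def] \<sigma>']
  note size = level_size_def log_mult pos
  \<comment> \<open>The first level refers to the codebook of \<open>X'\<close>, \<open>X\<close>,
    the second to that of \<open>Y'\<close>, \<open>Y\<close>. An unprimed letter occurs only
    together with its primed one, which leaves nine pairs; all but \<open>(0, 0)\<close> correspond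
    to one of the eight conditions.\<close>
  have "?ap 1 0"
    by (rule marginal[where w = "\<lambda>z. fst (fst z)" and rest = "\<lambda>z. (snd (fst z), fst (snd z), snd (snd z))" and full = "\<lambda>v (x, y', y). (v, x, y', y)"
          and glue = "\<lambda>((x', e), (x, y', y)). ((x', x, y', y), e)"])
      (use X' in \<open>auto simp: size same_level_def h_def prod_eq_iff add_ac split: prod.splits\<close>)
  moreover have "?ap 0 1"
    by (rule marginal[where w = "\<lambda>z. fst (snd z)" and rest = "\<lambda>z. (fst (fst z), snd (fst z), snd (snd z))" and full = "\<lambda>v (x', x, y). (x', x, v, y)"
          and glue = "\<lambda>((y', e), (x', x, y)). ((x', x, y', y), e)"])
      (use Y' in \<open>auto simp: size same_level_def h_def prod_eq_iff add_ac split: prod.splits\<close>)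
  moreover have "?ap 2 0"
    by (rule marginal[where w = "\<lambda>z. (fst (fst z), snd (fst z))" and rest = "\<lambda>z. (fst (snd z), snd (snd z))" and full = "\<lambda>(x', x) (y', y). (x', x, y', y)"
          and glue = "\<lambda>(((x', x), e), (y', y)). ((x', x, y', y), e)"])
      (use X'X in \<open>auto simp: size same_level_def h_def prod_eq_iff add_ac split: prod.splits\<close>)
  moreover have "?ap 0 2"
    by (rule marginal[where w = "\<lambda>z. (fst (snd z), snd (snd z))" and rest = "\<lambda>z. (fst (fst z), snd (fst z))" and full = "\<lambda>(y', y) (x', x). (x', x, y', y)"
          and glue = "\<lambda>(((y', y), e), (x', x)). ((x', x, y', y), e)"])
      (use Y'Y in \<open>auto simp: size same_level_def h_def prod_eq_iff add_ac split: prod.splits\<close>)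
  moreover have "?ap 1 1"
    by (rule marginal[where w = "\<lambda>z. (fst (fst z), fst (snd z))" and rest = "\<lambda>z. (snd (fst z), snd (snd z))" and full = "\<lambda>(x', y') (x, y). (x', x, y', y)"
          and glue = "\<lambda>(((x', y'), e), (x, y)). ((x', x, y', y), e)"])
      (use X'Y' in \<open>auto simp: size same_level_def h_def prod_eq_iff add_ac split: prod.splits\<close>)
  moreover have "?ap 1 2"
    by (rule marginal[where w = "\<lambda>z. (fst (fst z), fst (snd z), snd (snd z))" and rest = "\<lambda>z. snd (fst z)" and full = "\<lambda>(x', y', y) x. (x', x, y', y)"
          and glue = "\<lambda>(((x', y', y), e), x). ((x', x, y', y), e)"])
      (use X'Y'Y in \<open>auto simp: size same_level_def h_def prod_eq_iff add_ac split: prod.splits\<close>)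
  moreover have "?ap 2 1"
    by (rule marginal[where w = "\<lambda>z. (fst (fst z), snd (fst z), fst (snd z))" and rest = "\<lambda>z. snd (snd z)" and full = "\<lambda>(x', x, y') y. (x', x, y', y)"
          and glue = "\<lambda>(((x', x, y'), e), y). ((x', x, y', y), e)"])
      (use X'XY' in \<open>auto simp: size same_level_def h_def prod_eq_iff add_ac split: prod.splits\<close>)
  \<comment> \<open>No system is traced out here, and the label is the full quadruple
    \<open>h\<close>.\<close>
  moreover have "?ap 2 2"
    by (rule approx[OF _ \<sigma>'])
      (use X'XY'Y in \<open>auto simp: size same_level_def h_def prod_eq_iff add_ac split: prod.splits\<close>)
  ultimately have ap: "?ap i j" if "i \<le> 2" "j \<le> 2" "(i, j) \<noteq> (0, 0)" for i j
    using that by (elim level_cases) simp_all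
  \<comment> \<open>The deviation is a difference of positive operators, hence hermitian, so the
    Schatten norm can be exchanged for the dual one.\<close>
  have tn: "schatten_norm 1 ((1 / real (L' * L * M' * M)) *\<^sub>R
        (\<Sum>a'=1..L'. \<Sum>a=1..L. \<Sum>b'=1..M'. \<Sum>b=1..M.
          \<sigma>E (fst c a') (snd c (a', a)) (fst d b') (snd d (b', b))) - \<mu>) =
      trace_norm (sample2 L' L M' M s c d - \<mu>)" for c d
  proof -
    have "(1 / real (L' * L * M' * M)) *\<^sub>R
        (\<Sum>a'=1..L'. \<Sum>a=1..L. \<Sum>b'=1..M'. \<Sum>b=1..M.
          \<sigma>E (fst c a') (snd c (a', a)) (fst d b') (snd d (b', b))) = sample2 L' L M' M s c d"
      by (simp add: sample2_def sample_def s_def scaleR_sum_right mult_ac)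
    moreover have "psd (sample2 L' L M' M s c d)"
      unfolding sample2_def sample_def by (intro psd_scaleR psd_sum s) auto
    hence "hermitian (sample2 L' L M' M s c d - \<mu>)"
      using psd_hermitian psd_\<mu> hermitian_diff by blast
    ultimately show ?thesis using hermitian_norm_1(1) by metis
  qed
  have "CMG pX pY \<sigma>E L' L M' M = measure_pmf.expectation (pair_pmf (codebook pX L' L) (codebook pY M' M))
      (\<lambda>(c, d). trace_norm (sample2 L' L M' M s c d - \<mu>))"
    unfolding CMG_def \<sigma>[symmetric] \<mu> by (simp only: case_prod_beta' case_prod_beta tn)
  also have "\<dots> \<le> 57 / 2 * \<epsilon>"
    unfolding \<mu>_def by (rule covering_bound[OF pos eps(1) s V(1) V(2)[unfolded \<mu>_def] ap])
  also have "\<dots> < 31 * \<epsilon>" using eps by simp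
  finally show ?thesis .
qed

end
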